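(* Let $n\ge 1$, let $\Omega_1,\dots,\Omega_n$ be Polish spaces, $\mathbf\Omega=\prod_{i=1}^n\Omega_i$, and $\mathbf c=(c_1,\dots,c_n)\in\mathbb R_+^n$. Let $f:\mathbf\Omega\to\mathbb R$ be a (measurable) $\mathbf c$-Lipschitz function, let $G$ be a graph with vertex set $[n]$, and let $\mathbf X=(X_1,\dots,X_n)$ be a $G$-dependent $\mathbf\Omega$-valued random vector. If $G$ is a tree, then for every $t>0$, $$\mathbb P\left(f(\mathbf X)-\mathbb E[f(\mathbf X)]\ge t\right)\le \exp\left(-\frac{2t^2}{c_{\min}^2+\sum_{\{i,j\}\in E(G)}(c_i+c_j)^2}\right),$$ where $c_{\min}=\min_{1\le i\le n}c_i$.
   Context: $[n]=\{1,\dots,n\}$; $\mathbb R_+$ is the set of non-negative reals. Graphs are finite, undirected and simple; $V(G)$ and $E(G)$ are the vertex and edge sets. A tree is a connected acyclic graph. $X_i$ takes values in $\Omega_i$. A function $f:\mathbf\Omega\to\mathbb R$ is $\mathbf c$-Lipschitz if $|f(\mathbf x)-f(\mathbf x')|\le\sum_{i=1}^n c_i\mathbf 1_{\{x_i\ne x_i'\}}$ for all $\mathbf x=(x_1,\dots,x_n),\mathbf x'=(x_1',\dots,x_n')\in\mathbf\Omega$. A random vector $\mathbf X=(X_i)_{i\in V}$ is $G$-dependent, for a graph $G=(V,E)$, if for any disjoint $S,T\subset V$ that are non-adjacent in $G$ (no edge in $E$ has one endpoint in $S$ and the other in $T$), the families $\{X_i\}_{i\in S}$ and $\{X_j\}_{j\in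 T}$ are independent. *)

theory Defs
  imports "HOL-Probability.Probability"
begin

text \<open>
  The spaces \<open>\<Omega>\<^sub>1, \<dots>, \<Omega>\<^sub>n\<close> need not coincide, so they are given as a family of abstract
  topologies, whose carriers are arbitrary subsets of one ambient type, rather than through
  the type class of Polish spaces.
\<close>

definition polish_topology :: "'a topology \<Rightarrow> bool" where
  "polish_topology X \<longleftrightarrow>
     completely_metrizable_space X \<and>
     (\<exists>D. countable D \<and> D \<subseteq> topspace X \<and> X closure_of D = topspace X)"

definition borel_of :: "'a topology \<Rightarrow> 'a measure" where
  "borel_of X = sigma (topspace X) {U. openin X U}"

definition lipschitz_weighted ::
    "nat set \<Rightarrow> (nat \<Rightarrow> 'a set) \<Rightarrow> (nat \<Rightarrow> real) \<Rightarrow> ((nat \<Rightarrow> 'a) \<Rightarrow> real) \<Rightarrow> bool" where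
  "lipschitz_weighted I A c f \<longleftrightarrow>
     (\<forall>x \<in> Pi\<^sub>E I A. \<forall>x' \<in> Pi\<^sub>E I A.
        \<bar>f x - f x'\<bar> \<le> (\<Sum>i\<in>I. c i * of_bool (x i \<noteq> x' i)))"

text \<open>
  Graphs have undirected edges, represented as two-element sets of vertices, so that an edge
  sum counts each edge once. (In the symmetric digraphs of the AFP entry Graph Theory, every
  edge already forms a directed cycle, so the notion of tree defined there does not apply.)
\<close>

definition simple_graph :: "'v set \<Rightarrow> 'v set set \<Rightarrow> bool" where
  "simple_graph V E \<longleftrightarrow> finite V \<and> (\<forall>e\<in>E. e \<subseteq> V \<and> card e = 2)"

definition graph_walk :: "'v set \<Rightarrow> 'v set set \<Rightarrow> 'v list \<Rightarrow> bool" where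
  "graph_walk V E p \<longleftrightarrow> p \<noteq> [] \<and> set p \<subseteq> V \<and> successively (\<lambda>u v. {u, v} \<in> E) p"

definition graph_connected :: "'v set \<Rightarrow> 'v set set \<Rightarrow> bool" where
  "graph_connected V E \<longleftrightarrow>
     V \<noteq> {} \<and> (\<forall>u\<in>V. \<forall>v\<in>V. \<exists>p. graph_walk V E p \<and> hd p = u \<and> last p = v)"

text \<open>A cycle is listed without repeating its first vertex at the end.\<close>

definition graph_cycle :: "'v set \<Rightarrow> 'v set set \<Rightarrow> 'v list \<Rightarrow> bool" where
  "graph_cycle V E p \<longleftrightarrow>
     graph_walk V E p \<and> distinct p \<and> length p \<ge> 3 \<and> {last p, hd p} \<in> E"

definition graph_tree :: "'v set \<Rightarrow> 'v set set \<Rightarrow> bool" where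
  "graph_tree V E \<longleftrightarrow>
     simple_graph V E \<and> graph_connected V E \<and> (\<nexists>p. graph_cycle V E p)"

text \<open>
  Independence of the families \<open>{X\<^sub>i}\<close>, \<open>i \<in> S\<close>, and \<open>{X\<^sub>j}\<close>, \<open>j \<in> T\<close>, is independence of the
  random vectors they form.
\<close>

definition graph_dependent ::
    "'w measure \<Rightarrow> (nat \<Rightarrow> 'a measure) \<Rightarrow> nat set \<Rightarrow> nat set set \<Rightarrow> (nat \<Rightarrow> 'w \<Rightarrow> 'a) \<Rightarrow> bool" where
  "graph_dependent P N V E X \<longleftrightarrow>
     (\<forall>S T. S \<subseteq> V \<longrightarrow> T \<subseteq> V \<longrightarrow> S \<inter> T = {} \<longrightarrow> (\<forall>i\<in>S. \<forall>j\<in>T. {i, j} \<notin> E) \<longrightarrow>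
        prob_space.indep_var P
          (Pi\<^sub>M S N) (\<lambda>\<omega>. \<lambda>i\<in>S. X i \<omega>)
          (Pi\<^sub>M T N) (\<lambda>\<omega>. \<lambda>j\<in>T. X j \<omega>))"

text \<open>
  The bound \<open>exp (- 2 t\<^sup>2 / d)\<close> for \<open>d \<ge> 0\<close>. For \<open>d = 0\<close> it is read as \<open>exp (- \<infinity>) = 0\<close>;
  with the convention \<open>x / 0 = 0\<close> the plain quotient would give the vacuous bound 1 there.
\<close>

definition gauss_tail :: "real \<Rightarrow> real \<Rightarrow> real" where
  "gauss_tail d t = (if d = 0 then 0 else exp (- (2 * t\<^sup>2 / d)))"

end

theory Submission
  imports Defs
begin

text \<open>
  Root the tree at a vertex \<open>r\<close> with \<open>c r = c\<^sub>m\<^sub>i\<^sub>n\<close> and reveal the coordinates leaf by leaf, the root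
  last. A leaf \<open>v\<close> with neighbour \<open>p\<close> is independent of all coordinates other than \<open>v\<close> and \<open>p\<close>, so
  the conditional mean of \<open>f\<close> given \<open>X\<^sub>v\<close> ranges over an interval of length \<open>c v + c p\<close>, and
  conditioning on \<open>X\<^sub>v\<close> leaves a vector that is dependent along the smaller tree. Hoeffding's lemma
  and induction then bound the moment generating function by
  \<open>exp (l\<^sup>2 / 8 * (c\<^sub>m\<^sub>i\<^sub>n\<^sup>2 + (\<Sum>e\<in>E. (\<Sum>i\<in>e. c i)\<^sup>2)))\<close>.

  The induction is carried out for finitely valued vectors, where conditioning is elementary; no
  disintegration is needed. The reduction to that case uses inner regularity: off an event
  of small probability, the vector \<open>X\<close> lies in finitely many compact sets on each of which \<open>f\<close> is
  nearly constant, and by compactness the values on a sufficiently fine partition of the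
  coordinates are Lipschitz up to a small error, which McShane's extension removes.
\<close>

section \<open>Growing a tree by leaves\<close>

text \<open>Read backwards, a derivation strips leaves until only \<open>r\<close> is left, which is
  the order in which coordinates are conditioned on. The root is a fixed parameter, so any chosen
  vertex of a tree can be made the last one.\<close>

inductive rooted_tree :: "'v \<Rightarrow> 'v set \<Rightarrow> 'v set set \<Rightarrow> bool" for r where
  root: "rooted_tree r {r} {}"
| leaf: "rooted_tree r V E \<Longrightarrow> p \<in> V \<Longrightarrow> v \<notin> V \<Longrightarrow> rooted_tree r (insert v V) (insert {v, p} E)"

lemma rooted_tree_finite:
  "rooted_tree r V E \<Longrightarrow> finite V \<and> finite E \<and> r \<in> V \<and> (\<forall>e\<in>E. e \<subseteq> V)"
  by (induction rule: rooted_tree.induct) auto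

lemma graph_walk_mono:
  assumes "graph_walk V E p" "V \<subseteq> V'" "E \<subseteq> E'"
  shows "graph_walk V' E' p"
  using assms unfolding graph_walk_def
  by (auto elim!: successively_mono)

text \<open>Supplies the repetition-free path that would close to a cycle if an outside vertex had
  two neighbours in the subtree grown so far.\<close>

lemma rooted_tree_path:
  assumes "rooted_tree r V E" "a \<in> V" "b \<in> V"
  shows "\<exists>p. graph_walk V E p \<and> distinct p \<and> hd p = a \<and> last p = b"
  using assms
proof (induction arbitrary: a b rule: rooted_tree.induct)
  case root
  then show ?case by (intro exI[of _ "[r]"]) (auto simp: graph_walk_def)
next
  case (leaf V E q v)
  let ?V = "insert v V" and ?E = "insert {v, q} E"
  have mono: "graph_walk ?V ?E p" if "graph_walk V E p" for p
    using that by (rule graph_walk_mono) auto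
  have inV: "set p \<subseteq> V" "p \<noteq> []" if "graph_walk V E p" for p
    using that by (auto simp: graph_walk_def)
  consider "a = v" "b = v" | "a = v" "b \<in> V" | "a \<in> V" "b = v" | "a \<in> V" "b \<in> V"
    using leaf.prems by auto
  then show ?case
  proof cases
    case 1
    then show ?thesis by (intro exI[of _ "[v]"]) (auto simp: graph_walk_def)
  next
    case 2
    then obtain p where p: "graph_walk V E p" "distinct p" "hd p = q" "last p = b"
      using leaf.IH leaf.hyps by blast
    have "graph_walk ?V ?E (v # p)" "distinct (v # p)"
      using mono[OF p(1)] p inV[OF p(1)] leaf.hyps
      by (auto simp: graph_walk_def successively_Cons)
    then show ?thesis using 2 p inV[OF p(1)] by (intro exI[of _ "v # p"]) auto
  next
    case 3
    then obtain p where p: "graph_walk V E p" "distinct p" "hd p = a" "last p = q"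
      using leaf.IH leaf.hyps by blast
    have "graph_walk ?V ?E (p @ [v])" "distinct (p @ [v])"
      using mono[OF p(1)] p inV[OF p(1)] leaf.hyps
      by (auto simp: graph_walk_def successively_append_iff insert_commute)
    then show ?thesis using 3 p inV[OF p(1)] by (intro exI[of _ "p @ [v]"]) auto
  next
    case 4
    then show ?thesis using leaf.IH mono by blast
  qed
qed

text \<open>A discrete intermediate value argument: membership in \<open>W\<close> must switch off
  somewhere along the list. On a walk this gives an edge leaving \<open>W\<close>.\<close>

lemma successively_crossing:
  assumes "successively R p" "p \<noteq> []" "hd p \<in> W" "last p \<notin> W"
  shows "\<exists>x y. x \<in> set p \<and> y \<in> set p \<and> R x y \<and> x \<in> W \<and> y \<notin> W"
  using assms
proof (induction p rule: induct_list012)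
  case (3 x y zs)
  show ?case
  proof (cases "y \<in> W")
    case True
    then show ?thesis using 3 by fastforce
  next
    case False
    then show ?thesis using 3 by fastforce
  qed
qed auto

text \<open>Connectedness gives an edge from the subtree built so far to a new vertex, and
  acyclicity makes it the only one at that vertex, so the vertex is attached as a leaf.\<close>

lemma graph_tree_rooted:
  assumes tree: "graph_tree V E" and r: "r \<in> V"
  shows "rooted_tree r V E"
proof -
  have fin: "finite V" and edge: "\<And>e. e \<in> E \<Longrightarrow> e \<subseteq> V \<and> card e = 2"
    and acyclic: "\<And>p. \<not> graph_cycle V E p"
    using tree by (auto simp: graph_tree_def simple_graph_def)
  \<comment> \<open>The edges are kept equal to those induced on \<open>W\<close>, so that at
    \<open>k = card V\<close> they are all of \<open>E\<close>.\<close>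
  have "\<exists>W. W \<subseteq> V \<and> card W = k \<and> rooted_tree r W {e \<in> E. e \<subseteq> W}"
    if "1 \<le> k" "k \<le> card V" for k
    using that
  proof (induction k rule: dec_induct)
    case base
    have none: "{e \<in> E. e \<subseteq> {r}} = {}"
    proof (rule ccontr)
      assume "{e \<in> E. e \<subseteq> {r}} \<noteq> {}"
      then obtain e where "e \<in> E" "e \<subseteq> {r}" by auto
      then have "card e = 2" "card e \<le> 1" using edge card_mono[of "{r}" e] by auto
      then show False by simp
    qed
    have "rooted_tree r {r} {e \<in> E. e \<subseteq> {r}}" unfolding none by (rule rooted_tree.root)
    then show ?case using r by (intro exI[of _ "{r}"]) simp
  next
    case (step k)
    then obtain W where W: "W \<subseteq> V" "card W = k" "rooted_tree r W {e \<in> E. e \<subseteq> W}" by auto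
    have rW: "r \<in> W" using rooted_tree_finite[OF W(3)] by simp
    obtain u where u: "u \<in> V" "u \<notin> W" using W step.prems by (metis Suc_n_not_le_n subsetI subset_antisym)
    obtain p where p: "graph_walk V E p" "hd p = r" "last p = u"
      using tree r u unfolding graph_tree_def graph_connected_def by blast
    obtain w v where wv: "{w, v} \<in> E" "w \<in> W" "v \<notin> W"
      using successively_crossing[of "\<lambda>u v. {u, v} \<in> E" p W] p rW u by (auto simp: graph_walk_def)
    have vV: "v \<in> V" using edge[OF wv(1)] by auto
    have uniq: "w' = w" if w': "{w', v} \<in> E" "w' \<in> W" for w'
    proof (rule ccontr)
      assume ne: "w' \<noteq> w"
      obtain p where p: "graph_walk W {e \<in> E. e \<subseteq> W} p" "distinct p" "hd p = w" "last p = w'"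
        using rooted_tree_path[OF W(3) wv(2) w'(2)] by blast
      have pE: "graph_walk V E p" using p(1) W(1) by (rule graph_walk_mono) auto
      \<comment> \<open>The ends of \<open>p\<close> differ, so prefixing \<open>v\<close> gives the
        three vertices that a cycle requires.\<close>
      have "length p \<ge> 2" using p ne
        by (cases p rule: remdups_adj.cases) (auto simp: graph_walk_def)
      moreover have "graph_walk V E (v # p)"
        using pE wv(1) vV p(3) by (auto simp: graph_walk_def successively_Cons insert_commute)
      ultimately have "graph_cycle V E (v # p)"
        using p wv w' by (auto simp: graph_cycle_def graph_walk_def)
      then show False using acyclic by blast
    qed
    have "{e \<in> E. e \<subseteq> insert v W} = insert {v, w} {e \<in> E. e \<subseteq> W}"
    proof (intro equalityI subsetI)
      fix e assume e: "e \<in> {e \<in> E. e \<subseteq> insert v W}"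
      show "e \<in> insert {v, w} {e \<in> E. e \<subseteq> W}"
      proof (cases "v \<in> e")
        case True
        moreover have "card e = 2" using e edge by auto
        ultimately obtain w' where "e = {w', v}" "w' \<noteq> v"
          by (metis card_2_iff doubleton_eq_iff insertE singletonD)
        then show ?thesis using uniq[of w'] e by (auto simp: insert_commute)
      next
        case False
        then show ?thesis using e by auto
      qed
    qed (use wv in \<open>auto simp: insert_commute\<close>)
    moreover have "rooted_tree r (insert v W) (insert {v, w} {e \<in> E. e \<subseteq> W})"
      using W(3) wv by (intro rooted_tree.leaf) auto
    moreover have "card (insert v W) = Suc k"
      using wv(3) W(2) finite_subset[OF W(1) fin] by simp
    moreover have "insert v W \<subseteq> V" using vV W(1) by simp
    ultimately show ?case by (intro exI[of _ "insert v W"]) simp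
  qed
  from this[of "card V"] obtain W where W: "W \<subseteq> V" "card W = card V" "rooted_tree r W {e \<in> E. e \<subseteq> W}"
    using r fin by (auto simp: Suc_le_eq card_gt_0_iff)
  then have "W = V" using fin by (simp add: card_subset_eq)
  moreover have "{e \<in> E. e \<subseteq> V} = E" using edge by auto
  ultimately show ?thesis using W by simp
qed

section \<open>The moment generating function of a finitely valued vector\<close>

lemma measure_cond_pmf:
  assumes "set_pmf q \<inter> s \<noteq> {}"
  shows "measure (cond_pmf q s) A = measure q (A \<inter> s) / measure q s"
proof -
  have "measure (uniform_measure q s) A = measure q (s \<inter> A) / measure q s"
    using emeasure_measure_pmf_not_zero[OF assms] by (intro measure_uniform_measure) auto
  then show ?thesis unfolding cond_pmf.rep_eq[OF assms] Int_commute[of A s] .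
qed

text \<open>Hoeffding's lemma for nonnegative integrals, carried over to expectations; finite
  support supplies integrability.\<close>

lemma Hoeffding_mgf_pmf:
  fixes f :: "'a \<Rightarrow> real"
  assumes fin: "finite (set_pmf q)" and l: "l > 0" and ab: "\<And>x. x \<in> set_pmf q \<Longrightarrow> f x \<in> {a..b}"
  shows "measure_pmf.expectation q (\<lambda>x. exp (l * (f x - measure_pmf.expectation q f)))
         \<le> exp (l\<^sup>2 * (b - a)\<^sup>2 / 8)"
proof -
  interpret interval_bounded_random_variable q f a b
    by unfold_locales (use ab in \<open>auto simp: AE_measure_pmf_iff\<close>)
  let ?g = "\<lambda>x. exp (l * (f x - measure_pmf.expectation q f))"
  have "ennreal (measure_pmf.expectation q ?g) = (\<integral>\<^sup>+x. ennreal (?g x) \<partial>q)"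
    using fin by (intro nn_integral_eq_integral[symmetric] integrable_measure_pmf_finite) auto
  also have "\<dots> \<le> ennreal (exp (l\<^sup>2 * (b - a)\<^sup>2 / 8))"
    using l by (rule Hoeffdings_lemma_nn_integral)
  finally show ?thesis by simp
qed

text \<open>Quantifying over all functions forces \<open>f\<close> to ignore coordinates outside
  \<open>V\<close>, so no extensionality conditions have to be carried along.\<close>

definition hamming_lipschitz :: "'v set \<Rightarrow> ('v \<Rightarrow> real) \<Rightarrow> (('v \<Rightarrow> 'b) \<Rightarrow> real) \<Rightarrow> bool" where
  "hamming_lipschitz V c f \<longleftrightarrow> (\<forall>x y. \<bar>f x - f y\<bar> \<le> (\<Sum>i\<in>V. c i * of_bool (x i \<noteq> y i)))"

text \<open>For finitely supported laws independence can be tested on point events. A single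
  assignment \<open>x\<close> serves both sets because they are disjoint.\<close>

definition pmf_graph_dependent :: "('v \<Rightarrow> 'b) pmf \<Rightarrow> 'v set \<Rightarrow> 'v set set \<Rightarrow> bool" where
  "pmf_graph_dependent q V E \<longleftrightarrow>
     (\<forall>S T x. S \<subseteq> V \<longrightarrow> T \<subseteq> V \<longrightarrow> S \<inter> T = {} \<longrightarrow> (\<forall>i\<in>S. \<forall>j\<in>T. {i, j} \<notin> E) \<longrightarrow>
        measure q {y. \<forall>i\<in>S \<union> T. y i = x i}
        = measure q {y. \<forall>i\<in>S. y i = x i} * measure q {y. \<forall>i\<in>T. y i = x i})"

lemma pmf_graph_dependentD:
  assumes "pmf_graph_dependent q V E" "S \<subseteq> V" "T \<subseteq> V" "S \<inter> T = {}"
    "\<And>i j. i \<in> S \<Longrightarrow> j \<in> T \<Longrightarrow> {i, j} \<notin> E"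
  shows "measure q {y. \<forall>i\<in>S \<union> T. y i = x i}
        = measure q {y. \<forall>i\<in>S. y i = x i} * measure q {y. \<forall>i\<in>T. y i = x i}"
proof -
  have "\<forall>i\<in>S. \<forall>j\<in>T. {i, j} \<notin> E" using assms(5) by simp
  with assms(2-4) show ?thesis
    by (rule assms(1)[unfolded pmf_graph_dependent_def, THEN spec, THEN spec, THEN spec,
          THEN mp, THEN mp, THEN mp, THEN mp])
qed

text \<open>The leaf \<open>v\<close> touches at most one of two non-adjacent sets, hence is independent of the
  other one jointly with the first.\<close>

lemma pmf_graph_dependent_cond_leaf:
  assumes dep: "pmf_graph_dependent q (insert v V) (insert {v, p} E)"
    and v: "v \<notin> V" and E: "\<And>e. e \<in> E \<Longrightarrow> e \<subseteq> V"
    and a: "set_pmf q \<inter> {y. y v = a} \<noteq> {}"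
  shows "pmf_graph_dependent (cond_pmf q {y. y v = a}) V E"
proof -
  let ?Q = "cond_pmf q {y. y v = a}"
  have pos: "measure q {y. y v = a} > 0"
    using a measure_pmf_posI[of _ q "{y. y v = a}"] by blast
  have cond: "measure ?Q {y. \<forall>i\<in>S. y i = x i}
      = measure q {y. \<forall>i\<in>insert v S. y i = (x(v := a)) i} / measure q {y. y v = a}"
    if "v \<notin> S" for S x
  proof -
    have "{y. \<forall>i\<in>S. y i = x i} \<inter> {y. y v = a} = {y. \<forall>i\<in>insert v S. y i = (x(v := a)) i}"
      using that by auto
    then show ?thesis using measure_cond_pmf[OF a] by simp
  qed
  \<comment> \<open>It suffices to treat \<open>p \<notin> T\<close>: \<open>p\<close> cannot lie in
    both sets, and the claim is symmetric in them. Then \<open>v\<close> can join \<open>S\<close>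
    without creating an edge to \<open>T\<close>.\<close>
  have *: "measure ?Q {y. \<forall>i\<in>S \<union> T. y i = x i}
        = measure ?Q {y. \<forall>i\<in>S. y i = x i} * measure ?Q {y. \<forall>i\<in>T. y i = x i}"
    if ST: "S \<subseteq> V" "T \<subseteq> V" "S \<inter> T = {}" "\<forall>i\<in>S. \<forall>j\<in>T. {i, j} \<notin> E" "p \<notin> T" for S T x
  proof -
    have vST: "v \<notin> S" "v \<notin> T" using ST v by auto
    let ?x = "x(v := a)" and ?W = "insert v V" and ?F = "insert {v, p} E"
    have vE: "{v, j} \<notin> E" for j using E[of "{v, j}"] v by blast
    have vT: "{v, j} \<notin> ?F" if "j \<in> T" for j
      using that ST(5) vE vST by (auto simp: doubleton_eq_iff)
    have eT: "{y. \<forall>i\<in>T. y i = ?x i} = {y. \<forall>i\<in>T. y i = x i}" using vST by auto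
    \<comment> \<open>\<open>1\<close> splits \<open>T\<close> off from \<open>S\<close> together
      with \<open>v\<close>, and \<open>2\<close> splits it off from \<open>v\<close> alone;
      dividing both by the probability of \<open>y v = a\<close> gives the conditional product
      rule.\<close>
    have 1: "measure q {y. \<forall>i\<in>insert v S \<union> T. y i = ?x i}
        = measure q {y. \<forall>i\<in>insert v S. y i = ?x i} * measure q {y. \<forall>i\<in>T. y i = ?x i}"
      using ST vST vT by (intro pmf_graph_dependentD[OF dep]) (auto simp: doubleton_eq_iff)
    have 2: "measure q {y. \<forall>i\<in>{v} \<union> T. y i = ?x i}
        = measure q {y. \<forall>i\<in>{v}. y i = ?x i} * measure q {y. \<forall>i\<in>T. y i = ?x i}"
      using ST vST vT by (intro pmf_graph_dependentD[OF dep]) auto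
    show ?thesis
      using 1 2 pos vST by (simp add: cond del: fun_upd_apply) (simp add: eT)
  qed
  show ?thesis
    unfolding pmf_graph_dependent_def
  proof (intro allI impI)
    fix S T x
    assume ST: "S \<subseteq> V" "T \<subseteq> V" "S \<inter> T = {}" "\<forall>i\<in>S. \<forall>j\<in>T. {i, j} \<notin> E"
    show "measure ?Q {y. \<forall>i\<in>S \<union> T. y i = x i}
        = measure ?Q {y. \<forall>i\<in>S. y i = x i} * measure ?Q {y. \<forall>i\<in>T. y i = x i}"
    proof (cases "p \<in> T")
      case True
      then have pS: "p \<notin> S" using ST by auto
      have TS: "\<forall>i\<in>T. \<forall>j\<in>S. {i, j} \<notin> E"
      proof (intro ballI)
        fix i j assume "i \<in> T" "j \<in> S"
        moreover have "{j, i} = {i, j}" by (rule insert_commute)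
        ultimately show "{i, j} \<notin> E" using ST(4) by metis
      qed
      have "measure ?Q {y. \<forall>i\<in>T \<union> S. y i = x i}
        = measure ?Q {y. \<forall>i\<in>T. y i = x i} * measure ?Q {y. \<forall>i\<in>S. y i = x i}"
        using ST pS TS by (intro *) auto
      then show ?thesis by (simp only: Un_commute[of S T] mult.commute)
    next
      case False
      then show ?thesis using ST by (intro *)
    qed
  qed
qed

lemma hamming_lipschitzD:
  assumes "hamming_lipschitz V c f"
  shows "\<bar>f x - f y\<bar> \<le> (\<Sum>i\<in>V. c i * of_bool (x i \<noteq> y i))"
  by (rule assms[unfolded hamming_lipschitz_def, THEN spec, THEN spec])

lemma hamming_lipschitz_upd:
  assumes f: "hamming_lipschitz (insert v V) c f" and "v \<notin> V" "finite V"
  shows "hamming_lipschitz V c (\<lambda>x. f (x(v := a)))"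
  unfolding hamming_lipschitz_def
proof (intro allI)
  fix x y
  have "\<bar>f (x(v := a)) - f (y(v := a))\<bar>
      \<le> (\<Sum>i\<in>insert v V. c i * of_bool ((x(v := a)) i \<noteq> (y(v := a)) i))"
    by (rule hamming_lipschitzD[OF f])
  also have "\<dots> = (\<Sum>i\<in>V. c i * of_bool ((x(v := a)) i \<noteq> (y(v := a)) i))"
    using assms by simp
  also have "\<dots> = (\<Sum>i\<in>V. c i * of_bool (x i \<noteq> y i))"
    using assms by (intro sum.cong) auto
  finally show "\<bar>f (x(v := a)) - f (y(v := a))\<bar> \<le> (\<Sum>i\<in>V. c i * of_bool (x i \<noteq> y i))" .
qed

text \<open>Used at several sizes of \<open>S\<close>: the empty set gives equality of values,
  \<open>{v, p}\<close> the range attached to an edge, and all of \<open>V\<close> the total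
  oscillation.\<close>

lemma hamming_lipschitz_bound:
  assumes "hamming_lipschitz V c f" "finite V" "S \<subseteq> V" "\<And>i. i \<in> V \<Longrightarrow> c i \<ge> 0"
    "\<And>i. i \<in> V - S \<Longrightarrow> x i = y i"
  shows "\<bar>f x - f y\<bar> \<le> sum c S"
proof -
  have "\<bar>f x - f y\<bar> \<le> (\<Sum>i\<in>V. c i * of_bool (x i \<noteq> y i))"
    by (rule hamming_lipschitzD[OF assms(1)])
  also have "\<dots> \<le> (\<Sum>i\<in>V. c i * of_bool (i \<in> S))"
    using assms by (intro sum_mono mult_left_mono) auto
  also have "\<dots> = sum c S" using assms
    by (intro sum.mono_neutral_cong_right) auto
  finally show ?thesis .
qed

text \<open>Given the leaf, the coordinates other than the leaf and its neighbour keep their law;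
  minimising \<open>f\<close> over those two coordinates therefore leaves a function whose conditional
  expectation is constant.\<close>

lemma leaf_cond_expectation_range:
  fixes f :: "('v \<Rightarrow> 'b) \<Rightarrow> real"
  assumes dep: "pmf_graph_dependent q (insert v V) (insert {v, p} E)"
    and v: "v \<notin> V" and p: "p \<in> V" and E: "\<And>e. e \<in> E \<Longrightarrow> e \<subseteq> V" and finV: "finite V"
    and c: "\<And>i. i \<in> insert v V \<Longrightarrow> c i \<ge> 0"
    and fin: "finite (set_pmf q)" and f: "hamming_lipschitz (insert v V) c f"
  shows "\<exists>l. \<forall>a. set_pmf q \<inter> {y. y v = a} \<noteq> {} \<longrightarrow>
          measure_pmf.expectation (cond_pmf q {y. y v = a}) f \<in> {l..l + (c v + c p)}"
proof -
  define h where "h x = (INF y\<in>{y. \<forall>i. i \<noteq> v \<and> i \<noteq> p \<longrightarrow> y i = x i}. f y)" for x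
  let ?T = "V - {p}"
  have vp: "v \<noteq> p" using v p by auto
  have vE: "{v, j} \<notin> E" for j using E[of "{v, j}"] v by blast
  have bound: "\<bar>f x - f y\<bar> \<le> c v + c p" if "\<forall>i. i \<noteq> v \<and> i \<noteq> p \<longrightarrow> y i = x i" for x y
    using hamming_lipschitz_bound[OF f, of "{v, p}" x y] finV p c vp that by auto
  have bdd: "bdd_below (f ` {y. \<forall>i. i \<noteq> v \<and> i \<noteq> p \<longrightarrow> y i = x i})" for x
  proof (rule bdd_belowI2)
    fix y assume "y \<in> {y. \<forall>i. i \<noteq> v \<and> i \<noteq> p \<longrightarrow> y i = x i}"
    then have "\<bar>f x - f y\<bar> \<le> c v + c p" using bound by auto
    then show "f x - (c v + c p) \<le> f y" by linarith
  qed
  have h_le: "h x \<le> f x" for x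
    unfolding h_def by (rule cINF_lower[OF bdd]) auto
  have h_ge: "f x \<le> h x + (c v + c p)" for x
  proof -
    have "f x - (c v + c p) \<le> h x"
      unfolding h_def
    proof (rule cINF_greatest)
      fix y assume "y \<in> {y. \<forall>i. i \<noteq> v \<and> i \<noteq> p \<longrightarrow> y i = x i}"
      then have "\<bar>f x - f y\<bar> \<le> c v + c p" using bound by auto
      then show "f x - (c v + c p) \<le> f y" by linarith
    qed auto
    then show ?thesis by simp
  qed
  \<comment> \<open>The competitor \<open>z\<close> takes \<open>v\<close> and \<open>p\<close> from
    \<open>y\<close> and the rest from \<open>x\<close>. It agrees with \<open>y\<close> on all of
    \<open>insert v V\<close>, so both have the same value under \<open>f\<close>. The reverse
    inequality follows by symmetry.\<close>
  have h_cong: "h x \<le> h x'" if xx': "\<And>i. i \<in> ?T \<Longrightarrow> x i = x' i" for x x'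
    unfolding h_def[of x']
  proof (rule cINF_greatest)
    fix y assume y: "y \<in> {y. \<forall>i. i \<noteq> v \<and> i \<noteq> p \<longrightarrow> y i = x' i}"
    define z where "z i = (if i = v \<or> i = p then y i else x i)" for i
    have "\<bar>f z - f y\<bar> \<le> sum c {}"
      by (rule hamming_lipschitz_bound[OF f]) (use finV c xx' y in \<open>auto simp: z_def\<close>)
    moreover have "h x \<le> f z" unfolding h_def by (rule cINF_lower[OF bdd]) (auto simp: z_def)
    ultimately show "h x \<le> f y" by simp
  qed auto
  have h_restrict: "h (restrict x ?T) = h x" for x
    by (intro antisym h_cong) auto
  \<comment> \<open>No edge joins \<open>v\<close> to \<open>?T\<close>, so conditioning on the leaf
    does not change the law of these coordinates. Points that are not extensional have mass 0 on
    both sides.\<close>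
  have law: "map_pmf (\<lambda>x. restrict x ?T) (cond_pmf q {y. y v = a}) = map_pmf (\<lambda>x. restrict x ?T) q"
    (is "map_pmf ?R ?Q = _") if a: "set_pmf q \<inter> {y. y v = a} \<noteq> {}" for a
  proof (rule pmf_eqI)
    fix x
    have pos: "measure q {y. y v = a} > 0"
      using a measure_pmf_posI[of _ q "{y. y v = a}"] by blast
    show "pmf (map_pmf ?R ?Q) x = pmf (map_pmf ?R q) x"
    proof (cases "x \<in> extensional ?T")
      case True
      let ?x = "x(v := a)"
      have eq: "?R -` {x} = {y. \<forall>i\<in>?T. y i = x i}"
      proof (intro equalityI subsetI)
        fix y assume "y \<in> {y. \<forall>i\<in>?T. y i = x i}"
        then show "y \<in> ?R -` {x}" using True by (auto simp: extensional_def fun_eq_iff)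
      next
        fix y assume "y \<in> ?R -` {x}"
        then have "x = ?R y" by simp
        then show "y \<in> {y. \<forall>i\<in>?T. y i = x i}" by simp
      qed
      have "measure q {y. \<forall>i\<in>{v} \<union> ?T. y i = ?x i}
        = measure q {y. \<forall>i\<in>{v}. y i = ?x i} * measure q {y. \<forall>i\<in>?T. y i = ?x i}"
        using v p vE by (intro pmf_graph_dependentD[OF dep]) (auto simp: doubleton_eq_iff)
      moreover have "{y. \<forall>i\<in>{v} \<union> ?T. y i = ?x i} = {y. \<forall>i\<in>?T. y i = x i} \<inter> {y. y v = a}"
        using v by auto
      moreover have "{y. \<forall>i\<in>?T. y i = ?x i} = {y. \<forall>i\<in>?T. y i = x i}" using v by auto
      ultimately show ?thesis
        using pos by (simp add: pmf_map eq measure_cond_pmf[OF a])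
    next
      case False
      then have "?R -` {x} = {}" by auto
      then show ?thesis by (simp add: pmf_map)
    qed
  qed
  show ?thesis
  \<comment> \<open>The lower end is the mean of \<open>h\<close>, which is the same for every
    \<open>a\<close>; the width comes from \<open>h \<le> f \<le> h + (c v + c p)\<close>.\<close>
  proof (intro exI[of _ "measure_pmf.expectation q h"] allI impI)
    fix a assume a: "set_pmf q \<inter> {y. y v = a} \<noteq> {}"
    let ?Q = "cond_pmf q {y. y v = a}"
    have finQ: "finite (set_pmf ?Q)" using fin a by simp
    have "measure_pmf.expectation ?Q h = measure_pmf.expectation (map_pmf (\<lambda>x. restrict x ?T) ?Q) h"
      by (simp add: h_restrict)
    also have "\<dots> = measure_pmf.expectation q h"
      unfolding law[OF a] by (simp add: h_restrict)
    finally have h: "measure_pmf.expectation ?Q h = measure_pmf.expectation q h" .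
    have "measure_pmf.expectation ?Q h \<le> measure_pmf.expectation ?Q f"
      by (intro integral_mono integrable_measure_pmf_finite finQ h_le)
    moreover have "measure_pmf.expectation ?Q f \<le> measure_pmf.expectation ?Q (\<lambda>x. h x + (c v + c p))"
      by (intro integral_mono integrable_measure_pmf_finite finQ h_ge)
    moreover have "measure_pmf.expectation ?Q (\<lambda>x. h x + (c v + c p))
        = measure_pmf.expectation ?Q h + (c v + c p)"
      using integrable_measure_pmf_finite[OF finQ, of h] by simp
    ultimately show "measure_pmf.expectation ?Q f
        \<in> {measure_pmf.expectation q h..measure_pmf.expectation q h + (c v + c p)}"
      using h by auto
  qed
qed

text \<open>Only the coordinate \<open>r\<close> matters, so \<open>f\<close> ranges over an
  interval of length \<open>c r\<close>. This produces the one term of the bound that belongs to a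
  vertex and not to an edge.\<close>

lemma single_vertex_mgf:
  fixes f :: "('v \<Rightarrow> 'b) \<Rightarrow> real"
  assumes l: "l > 0" and c: "c r \<ge> 0" and fin: "finite (set_pmf q)"
    and lip: "hamming_lipschitz {r} c f"
  shows "measure_pmf.expectation q (\<lambda>x. exp (l * (f x - measure_pmf.expectation q f)))
         \<le> exp (l\<^sup>2 * (c r)\<^sup>2 / 8)"
proof -
  define a where "a = (INF x. f x)"
  have diff: "f x - f y \<le> c r" for x y
    using hamming_lipschitz_bound[OF lip, of "{r}" x y] c by auto
  have bdd: "bdd_below (range f)"
  proof (rule bdd_belowI2)
    fix y show "f undefined - c r \<le> f y" using diff[of undefined y] by linarith
  qed
  have "f x \<in> {a..a + c r}" for x
  proof -
    have "a \<le> f x" unfolding a_def by (rule cINF_lower[OF bdd]) auto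
    moreover have "f x - c r \<le> a" unfolding a_def
      by (rule cINF_greatest) (use diff[of x] in \<open>auto simp: algebra_simps\<close>)
    ultimately show ?thesis by simp
  qed
  then show ?thesis
    using Hoeffding_mgf_pmf[OF fin l, of f a "a + c r"] by simp
qed

text \<open>With \<open>m\<close> the conditional mean given the leaf, the deviation of
  \<open>f\<close> splits into \<open>f - m\<close>, controlled by the induction hypothesis under
  each conditional law, and \<open>m\<close> minus its mean, controlled by Hoeffding's lemma on a
  range of length \<open>c v + c p\<close>.\<close>

lemma leaf_mgf:
  fixes f :: "('v \<Rightarrow> 'b) \<Rightarrow> real"
  assumes V: "finite V" and EV: "\<And>e. e \<in> E \<Longrightarrow> e \<subseteq> V" and p: "p \<in> V" and v: "v \<notin> V"
    and IH: "\<And>(q :: ('v \<Rightarrow> 'b) pmf) f. finite (set_pmf q) \<Longrightarrow> pmf_graph_dependent q V E \<Longrightarrow> hamming_lipschitz V c f \<Longrightarrow>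
        measure_pmf.expectation q (\<lambda>x. exp (l * (f x - measure_pmf.expectation q f)))
        \<le> exp (l\<^sup>2 * D / 8)"
    and l: "l > 0" and c: "\<And>i. i \<in> insert v V \<Longrightarrow> c i \<ge> 0" and fin: "finite (set_pmf q)"
    and dep: "pmf_graph_dependent q (insert v V) (insert {v, p} E)"
    and lip: "hamming_lipschitz (insert v V) c f"
  shows "measure_pmf.expectation q (\<lambda>x. exp (l * (f x - measure_pmf.expectation q f)))
         \<le> exp (l\<^sup>2 * (D + (c v + c p)\<^sup>2) / 8)"
proof -
  define Q where "Q a = cond_pmf q {y. y v = a}" for a
  define m where "m a = measure_pmf.expectation (Q a) f" for a
  define \<pi> where "\<pi> = map_pmf (\<lambda>x. x v) q"
  define A where "A = set_pmf \<pi>"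
  have finA: "finite A" unfolding A_def \<pi>_def using fin by simp
  have ne: "set_pmf q \<inter> {y. y v = a} \<noteq> {}" if "a \<in> A" for a
    using that by (auto simp: A_def \<pi>_def)
  have finQ: "finite (set_pmf (Q a))" if "a \<in> A" for a
    using fin ne[OF that] by (simp add: Q_def)
  have q: "q = \<pi> \<bind> Q"
    unfolding \<pi>_def Q_def
    by (rule bind_cond_pmf_cancel[symmetric])
       (auto simp: vimage_def intro!: arg_cong[where f = "measure q"])
  have E_q: "measure_pmf.expectation q g = (\<Sum>a\<in>A. pmf \<pi> a * measure_pmf.expectation (Q a) g)"
    for g :: "('v \<Rightarrow> 'b) \<Rightarrow> real"
    by (subst q, subst pmf_expectation_bind[OF finA]) (auto simp: finQ A_def)
  have E_\<pi>: "measure_pmf.expectation \<pi> g = (\<Sum>a\<in>A. pmf \<pi> a * g a)" for g :: "'b \<Rightarrow> real"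
    using integral_measure_pmf[OF finA, of \<pi> g] by (simp add: A_def)
  let ?\<mu> = "measure_pmf.expectation q f"
  have \<mu>: "?\<mu> = measure_pmf.expectation \<pi> m"
    unfolding E_q E_\<pi> m_def ..
  have IHa: "measure_pmf.expectation (Q a) (\<lambda>x. exp (l * (f x - m a))) \<le> exp (l\<^sup>2 * D / 8)"
    if a: "a \<in> A" for a
  proof -
    \<comment> \<open>Freezing the leaf at \<open>a\<close> gives a function that is Lipschitz over
      \<open>V\<close> alone and equals \<open>f\<close> almost surely under
      \<open>Q a\<close>.\<close>
    let ?f = "\<lambda>x. f (x(v := a))"
    have "AE x in Q a. ?f x = f x"
      using ne[OF a] by (auto simp: AE_measure_pmf_iff Q_def intro!: arg_cong[where f = f])
    then have 1: "measure_pmf.expectation (Q a) (\<lambda>x. g (?f x)) = measure_pmf.expectation (Q a) (\<lambda>x. g (f x))"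
      for g :: "real \<Rightarrow> real" by (intro integral_cong_AE) auto
    have "measure_pmf.expectation (Q a) (\<lambda>x. exp (l * (?f x - measure_pmf.expectation (Q a) ?f)))
      \<le> exp (l\<^sup>2 * D / 8)"
    proof (rule IH[of "Q a" ?f])
      show "pmf_graph_dependent (Q a) V E" unfolding Q_def
        by (rule pmf_graph_dependent_cond_leaf[OF dep v EV ne[OF a]])
      show "hamming_lipschitz V c ?f"
        by (rule hamming_lipschitz_upd[OF lip v V])
    qed (rule finQ[OF a])
    moreover have "measure_pmf.expectation (Q a) ?f = m a"
      unfolding m_def using 1[of "\<lambda>x. x"] by simp
    ultimately show ?thesis using 1[of "\<lambda>z. exp (l * (z - m a))"] by simp
  qed
  obtain b where b: "\<And>a. set_pmf q \<inter> {y. y v = a} \<noteq> {} \<Longrightarrow> m a \<in> {b..b + (c v + c p)}"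
    using leaf_cond_expectation_range[OF dep v p EV V c fin lip]
    unfolding m_def Q_def by blast
  \<comment> \<open>The second exponential factor is constant under \<open>Q a\<close> and leaves
    the inner expectation.\<close>
  have "measure_pmf.expectation q (\<lambda>x. exp (l * (f x - ?\<mu>)))
      = (\<Sum>a\<in>A. pmf \<pi> a * measure_pmf.expectation (Q a) (\<lambda>x. exp (l * (f x - m a)) * exp (l * (m a - ?\<mu>))))"
    unfolding E_q[of "\<lambda>x. exp (l * (f x - ?\<mu>))"]
    by (simp flip: exp_add add: algebra_simps)
  also have "\<dots> = (\<Sum>a\<in>A. pmf \<pi> a * (measure_pmf.expectation (Q a) (\<lambda>x. exp (l * (f x - m a))) * exp (l * (m a - ?\<mu>))))"
    by simp
  also have "\<dots> \<le> (\<Sum>a\<in>A. pmf \<pi> a * (exp (l\<^sup>2 * D / 8) * exp (l * (m a - ?\<mu>))))"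
    by (intro sum_mono mult_left_mono mult_right_mono IHa) auto
  also have "\<dots> = exp (l\<^sup>2 * D / 8) * measure_pmf.expectation \<pi> (\<lambda>a. exp (l * (m a - ?\<mu>)))"
    unfolding E_\<pi> by (simp add: sum_distrib_left mult_ac)
  also have "measure_pmf.expectation \<pi> (\<lambda>a. exp (l * (m a - ?\<mu>))) \<le> exp (l\<^sup>2 * (b + (c v + c p) - b)\<^sup>2 / 8)"
    unfolding \<mu> by (rule Hoeffding_mgf_pmf) (use finA l b ne in \<open>auto simp: A_def\<close>)
  also have "exp (l\<^sup>2 * D / 8) * exp (l\<^sup>2 * (b + (c v + c p) - b)\<^sup>2 / 8)
      = exp (l\<^sup>2 * (D + (c v + c p)\<^sup>2) / 8)"
    by (simp flip: exp_add add: field_simps)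
  finally show ?thesis by simp
qed

lemma rooted_tree_mgf:
  fixes f :: "('v \<Rightarrow> 'b) \<Rightarrow> real"
  assumes "rooted_tree r V E" and l: "l > 0"
    and "\<And>i. i \<in> V \<Longrightarrow> c i \<ge> 0" and "finite (set_pmf q)"
    and "pmf_graph_dependent q V E" and "hamming_lipschitz V c f"
  shows "measure_pmf.expectation q (\<lambda>x. exp (l * (f x - measure_pmf.expectation q f)))
         \<le> exp (l\<^sup>2 * ((c r)\<^sup>2 + (\<Sum>e\<in>E. (sum c e)\<^sup>2)) / 8)"
  using assms(1,3-)
proof (induction arbitrary: q f rule: rooted_tree.induct)
  case root
  from single_vertex_mgf[OF l root(1)[OF singletonI] root(2,4)] show ?case
    by (simp only: sum.empty add_0_right)
next
  case (leaf V E p v)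
  have V: "finite V" "finite E" and EV: "\<And>e. e \<in> E \<Longrightarrow> e \<subseteq> V"
    using rooted_tree_finite[OF leaf.hyps(1)] by auto
  \<comment> \<open>The edge is new, so the edge sum grows by exactly one term.\<close>
  have "{v, p} \<notin> E" using EV[of "{v, p}"] leaf.hyps(3) by blast
  moreover have "v \<noteq> p" using leaf.hyps(2,3) by blast
  then have "sum c {v, p} = c v + c p" by simp
  ultimately have D: "(c r)\<^sup>2 + (\<Sum>e\<in>insert {v, p} E. (sum c e)\<^sup>2)
      = ((c r)\<^sup>2 + (\<Sum>e\<in>E. (sum c e)\<^sup>2)) + (c v + c p)\<^sup>2"
    using V by simp
  have cV: "c i \<ge> 0" if "i \<in> V" for i using leaf.prems(1) that by blast
  show ?case
    unfolding D
    by (rule leaf_mgf[OF V(1) EV leaf.hyps(2,3) leaf.IH[OF cV] l leaf.prems])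
qed

section \<open>Discretisation on a Polish type\<close>

lemma inner_regular_compact:
  fixes M :: "'b :: polish_space measure"
  assumes "finite_measure M" and sets: "sets M = sets borel" and B: "B \<in> sets borel" and e: "e > 0"
  obtains K where "compact K" "K \<subseteq> B" "measure M B - e < measure M K"
proof -
  interpret finite_measure M by fact
  have "\<exists>K. compact K \<and> K \<subseteq> B \<and> measure M B - e < measure M K"
  proof (rule ccontr)
    assume none: "\<nexists>K. compact K \<and> K \<subseteq> B \<and> measure M B - e < measure M K"
    have le: "measure M K \<le> measure M B - e" if "compact K" "K \<subseteq> B" for K
    proof (rule ccontr)
      assume "\<not> measure M K \<le> measure M B - e"
      then have "measure M B - e < measure M K" by simp
      with none that show False by blast
    qed
    have "emeasure M B = (SUP K \<in> {K. K \<subseteq> B \<and> compact K}. emeasure M K)"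
      using emeasure_finite[of "space M"] by (intro inner_regular[OF sets _ B]) simp
    also have "\<dots> \<le> ennreal (measure M B - e)"
      by (rule SUP_least) (use le in \<open>auto simp: emeasure_eq_measure intro!: ennreal_leI\<close>)
    finally have "measure M B \<le> measure M B - e"
      using le[of "{}"] by (simp add: emeasure_eq_measure)
    then show False using e by simp
  qed
  then show ?thesis using that by blast
qed

text \<open>The bounded range of \<open>f\<close> is cut into levels of width \<open>d\<close>, and
  each level set is approximated from inside by a compact set.\<close>

lemma compact_level_family:
  fixes M :: "'b :: polish_space measure" and f :: "'b \<Rightarrow> real"
  assumes prob: "prob_space M" and sets: "sets M = sets borel" and f [measurable]: "f \<in> borel_measurable borel"
    and bdd: "\<And>x y. \<bar>f x - f y\<bar> \<le> B" and d: "d > 0" and e: "e > 0"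
  obtains F where "finite F" "\<And>K. K \<in> F \<Longrightarrow> compact K"
    "\<And>K x y. K \<in> F \<Longrightarrow> x \<in> K \<Longrightarrow> y \<in> K \<Longrightarrow> \<bar>f x - f y\<bar> \<le> d"
    "measure M (UNIV - \<Union>F) \<le> e"
proof -
  interpret prob_space M by fact
  \<comment> \<open>Since \<open>a\<close> is a lower bound and \<open>f - a\<close> is at most
    \<open>2 * B\<close>, the levels run from 0 to \<open>m\<close>; each of these
    \<open>m + 1\<close> levels may lose \<open>e / (m + 1)\<close>.\<close>
  define a where "a = f undefined - B"
  define L where "L x = nat \<lfloor>(f x - a) / d\<rfloor>" for x
  define m where "m = nat \<lfloor>2 * B / d\<rfloor>"
  have L_le: "L x \<le> m" for x
  proof -
    have "f x - a \<le> 2 * B" using bdd[of x undefined] by (auto simp: a_def)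
    then show ?thesis using d unfolding L_def m_def
      by (intro nat_mono floor_mono divide_right_mono) auto
  qed
  have L_eq: "\<bar>f x - f y\<bar> \<le> d" if "L x = L y" for x y
  proof -
    have nonneg: "0 \<le> (f z - a) / d" for z
      using bdd[of z undefined] d by (auto simp: a_def)
    have "int (L z) = \<lfloor>(f z - a) / d\<rfloor>" for z
      unfolding L_def using nonneg[of z] by (intro int_nat_eq[THEN trans]) simp
    then have "\<lfloor>(f x - a) / d\<rfloor> = \<lfloor>(f y - a) / d\<rfloor>"
      using that by metis
    then have "\<bar>(f x - a) / d - (f y - a) / d\<bar> < 1" by linarith
    also have "(f x - a) / d - (f y - a) / d = (f x - f y) / d"
      by (simp add: diff_divide_distrib)
    finally show ?thesis using d by (simp add: abs_divide divide_less_eq)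
  qed
  have L_sets: "L -` {j} \<in> sets borel" for j
  proof -
    have "L \<in> measurable borel (count_space UNIV)" unfolding L_def by measurable
    from measurable_sets[OF this, of "{j}"] show ?thesis by simp
  qed
  have "\<exists>K. compact K \<and> K \<subseteq> L -` {j} \<and> measure M (L -` {j}) - e / (m + 1) < measure M K" for j
    using inner_regular_compact[OF finite_measure_axioms sets L_sets, of "e / (m + 1)" j] e by auto
  then obtain K where K: "\<And>j. compact (K j)" "\<And>j. K j \<subseteq> L -` {j}"
      "\<And>j. measure M (L -` {j}) - e / (m + 1) < measure M (K j)" by metis
  have K_sets: "K j \<in> sets M" for j
    using K(1)[of j] by (simp add: sets borel_closed compact_imp_closed)
  have "measure M (UNIV - \<Union>(K ` {..m})) \<le> measure M (\<Union>j\<in>{..m}. L -` {j} - K j)"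
    using L_le L_sets K_sets by (intro finite_measure_mono) (auto simp: sets)
  also have "\<dots> \<le> (\<Sum>j\<le>m. measure M (L -` {j} - K j))"
    using L_sets K_sets by (intro finite_measure_subadditive_finite) (auto simp: sets)
  also have "\<dots> \<le> (\<Sum>j\<le>m. e / (m + 1))"
  proof (rule sum_mono)
    fix j
    have "measure M (L -` {j} - K j) = measure M (L -` {j}) - measure M (K j)"
      using L_sets K_sets K(2) by (intro finite_measure_Diff) (auto simp: sets)
    then show "measure M (L -` {j} - K j) \<le> e / (m + 1)" using K(3)[of j] by linarith
  qed
  also have "\<dots> = e" by simp
  finally have "measure M (UNIV - \<Union>(K ` {..m})) \<le> e" .
  moreover have "\<bar>f x - f y\<bar> \<le> d" if "C \<in> K ` {..m}" "x \<in> C" "y \<in> C" for C x y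
  proof (rule L_eq)
    from that obtain j where "x \<in> K j" "y \<in> K j" by auto
    then have "x \<in> L -` {j}" "y \<in> L -` {j}" using K(2) by blast+
    then show "L x = L y" by simp
  qed
  ultimately show ?thesis using K(1) by (intro that[of "K ` {..m}"]) auto
qed

text \<open>On a product of two compact sets that contains no pair agreeing outside \<open>J\<close>, the distance of
  the remaining coordinates is bounded away from 0.\<close>

lemma approx_lipschitz_compact:
  fixes f :: "('i :: countable \<Rightarrow> 'b :: polish_space) \<Rightarrow> real"
  assumes lip: "hamming_lipschitz I c f" and I: "finite I" "J \<subseteq> I" and c: "\<And>i. i \<in> I \<Longrightarrow> c i \<ge> 0"
    and K: "compact K" "compact K'"
    and osc: "\<And>x y. x \<in> K \<Longrightarrow> y \<in> K \<Longrightarrow> \<bar>f x - f y\<bar> \<le> d" "\<And>x y. x \<in> K' \<Longrightarrow> y \<in> K' \<Longrightarrow> \<bar>f x - f y\<bar> \<le> d"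
  shows "\<forall>\<^sub>F \<rho> in at_right 0. \<forall>x\<in>K. \<forall>y\<in>K'. (\<forall>i\<in>I - J. dist (x i) (y i) < \<rho>) \<longrightarrow>
           \<bar>f x - f y\<bar> \<le> sum c J + 2 * d"
proof (cases "\<exists>x\<in>K. \<exists>y\<in>K'. \<forall>i\<in>I - J. x i = y i")
  case True
  then obtain x y where xy: "x \<in> K" "y \<in> K'" "\<And>i. i \<in> I - J \<Longrightarrow> x i = y i" by blast
  have "\<bar>f x - f y\<bar> \<le> sum c J"
    by (rule hamming_lipschitz_bound[OF lip I c xy(3)])
  \<comment> \<open>The oscillation bounds carry the estimate from the one pair \<open>x\<close>,
    \<open>y\<close> to every pair, at a cost of \<open>d\<close> on each side.\<close>
  then have "\<bar>f x' - f y'\<bar> \<le> sum c J + 2 * d" if "x' \<in> K" "y' \<in> K'" for x' y'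
    using osc(1)[OF xy(1) that(1)] osc(2)[OF xy(2) that(2)] by linarith
  then show ?thesis by (intro always_eventually) blast
next
  case False
  show ?thesis
  proof (cases "K \<times> K' = {}")
    case True
    then show ?thesis by (intro always_eventually) auto
  next
    case ne: False
    define D where "D p = (\<Sum>i\<in>I - J. dist (fst p i) (snd p i))" for p :: "('i \<Rightarrow> 'b) \<times> ('i \<Rightarrow> 'b)"
    have coord: "continuous_on A (\<lambda>p. fst p i)" "continuous_on A (\<lambda>p. snd p i)"
      for A :: "(('i \<Rightarrow> 'b) \<times> ('i \<Rightarrow> 'b)) set" and i
      using continuous_on_compose2[OF continuous_on_product_coordinates[of i] continuous_on_fst[OF continuous_on_id]]
        continuous_on_compose2[OF continuous_on_product_coordinates[of i] continuous_on_snd[OF continuous_on_id]]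
      by auto
    have "continuous_on (K \<times> K') D"
      unfolding D_def by (intro continuous_on_sum continuous_on_dist coord)
    then obtain p where p: "p \<in> K \<times> K'" "\<And>q. q \<in> K \<times> K' \<Longrightarrow> D p \<le> D q"
      using continuous_attains_inf[OF compact_Times[OF K] ne] by blast
    have "D p \<noteq> 0"
    proof
      assume "D p = 0"
      then have "\<forall>i\<in>I - J. fst p i = snd p i"
        using I by (simp add: D_def sum_nonneg_eq_0_iff)
      moreover have "fst p \<in> K" "snd p \<in> K'" using p(1) by auto
      ultimately show False using False by blast
    qed
    moreover have "D p \<ge> 0" by (simp add: D_def sum_nonneg)
    ultimately have pos: "D p > 0" by simp
    show ?thesis
    \<comment> \<open>Below this threshold the coordinate distances would sum to less than the
      minimum \<open>D p\<close>, so no pair satisfies the premise.\<close>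
    proof (rule eventually_at_rightI[of 0 "D p / (card (I - J) + 1)"])
      fix \<rho> assume \<rho>: "\<rho> \<in> {0<..<D p / (card (I - J) + 1)}"
      show "\<forall>x\<in>K. \<forall>y\<in>K'. (\<forall>i\<in>I - J. dist (x i) (y i) < \<rho>) \<longrightarrow> \<bar>f x - f y\<bar> \<le> sum c J + 2 * d"
      proof (intro ballI impI)
        fix x y assume xy: "x \<in> K" "y \<in> K'" "\<forall>i\<in>I - J. dist (x i) (y i) < \<rho>"
        have "D p \<le> D (x, y)" using p(2) xy by simp
        also have "\<dots> \<le> (\<Sum>i\<in>I - J. \<rho>)"
          unfolding D_def using xy(3) by (intro sum_mono) (simp add: less_imp_le)
        also have "\<dots> = card (I - J) * \<rho>" by simp
        also have "\<dots> < (card (I - J) + 1) * \<rho>" using \<rho> by (simp add: algebra_simps)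
        also have "\<dots> < D p" using \<rho> by (simp add: field_simps)
        finally show "\<bar>f x - f y\<bar> \<le> sum c J + 2 * d" by simp
      qed
    qed (use pos in simp)
  qed
qed

text \<open>Each point is labelled by the first ball of radius \<open>r / 2\<close> containing it,
  from a finite cover of \<open>C\<close>; two points of \<open>C\<close> with the same label are
  close to the same centre.\<close>

lemma compact_cells:
  fixes C :: "'b :: polish_space set"
  assumes "compact C" and r: "r > 0"
  obtains \<phi> :: "'b \<Rightarrow> nat" and N where "\<phi> \<in> measurable borel (count_space UNIV)" "\<And>z. \<phi> z \<le> N"
    "\<And>x y. x \<in> C \<Longrightarrow> y \<in> C \<Longrightarrow> \<phi> x = \<phi> y \<Longrightarrow> dist x y < r"
proof -
  obtain S where S: "finite S" "C \<subseteq> (\<Union>x\<in>S. ball x (r / 2))"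
    by (rule compactE_image[OF assms(1), of C "\<lambda>x. ball x (r / 2)"]) (use r in auto)
  obtain xs where xs: "set xs = S" using finite_list[OF S(1)] by blast
  \<comment> \<open>The first disjunct gives points in no ball the label \<open>length xs\<close>,
    so the minimum always exists and the labels are bounded.\<close>
  define \<phi> where "\<phi> z = (LEAST j. j \<ge> length xs \<or> dist (xs ! j) z < r / 2)" for z
  have near: "dist (xs ! \<phi> z) z < r / 2" if "z \<in> C" for z
  proof -
    obtain x where "x \<in> S" "dist x z < r / 2" using S(2) \<open>z \<in> C\<close> by auto
    then obtain j where j: "j < length xs" "dist (xs ! j) z < r / 2"
      using xs by (metis in_set_conv_nth)
    have "\<phi> z \<le> j" unfolding \<phi>_def by (rule Least_le) (use j in simp)
    moreover have "\<phi> z \<ge> length xs \<or> dist (xs ! \<phi> z) z < r / 2"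
      unfolding \<phi>_def by (rule LeastI) (use j in blast)
    ultimately show ?thesis using j by simp
  qed
  show ?thesis
  proof (rule that[of \<phi> "length xs"])
    show "\<phi> \<in> measurable borel (count_space UNIV)"
      unfolding \<phi>_def by measurable
    show "\<phi> z \<le> length xs" for z
      unfolding \<phi>_def by (rule Least_le) simp
    show "dist x y < r" if "x \<in> C" "y \<in> C" "\<phi> x = \<phi> y" for x y
      using near[of x] near[of y] that dist_triangle_half_r[of "xs ! \<phi> x" x r y]
      by (simp add: dist_commute)
  qed
qed

text \<open>McShane's extension with respect to the weighted Hamming distance.\<close>

lemma hamming_lipschitz_extension:
  fixes f :: "'a \<Rightarrow> real" and \<Phi> :: "'a \<Rightarrow> 'v \<Rightarrow> 'b"
  assumes I: "finite I" and c: "\<And>i. i \<in> I \<Longrightarrow> c i \<ge> 0" and ne: "K \<noteq> {}"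
    and bdd: "\<And>x y. \<bar>f x - f y\<bar> \<le> sum c I"
    and lip: "\<And>x y. x \<in> K \<Longrightarrow> y \<in> K \<Longrightarrow> \<bar>f x - f y\<bar> \<le> sum c {i \<in> I. \<Phi> x i \<noteq> \<Phi> y i} + d"
  shows "\<exists>g. hamming_lipschitz I c g \<and> (\<forall>x\<in>K. \<bar>f x - g (\<Phi> x)\<bar> \<le> d) \<and>
           (\<forall>s x. \<bar>g s - f x\<bar> \<le> 2 * sum c I)"
proof -
  define D where "D s s' = (\<Sum>i\<in>I. c i * of_bool (s i \<noteq> s' i))" for s s' :: "'v \<Rightarrow> 'b"
  have D_eq: "D s s' = sum c {i \<in> I. s i \<noteq> s' i}" for s s'
  proof -
    have "D s s' = (\<Sum>i\<in>I. if s i \<noteq> s' i then c i else 0)"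
      unfolding D_def by (intro sum.cong) auto
    then show ?thesis using I by (simp add: sum.inter_filter)
  qed
  have D_nonneg: "D s s' \<ge> 0" for s s'
    unfolding D_eq using c by (intro sum_nonneg) auto
  have D_le: "D s s' \<le> sum c I" for s s'
    unfolding D_eq using c I by (intro sum_mono2) auto
  have D_tri: "D s s'' \<le> D s' s'' + D s s'" for s s' s''
    unfolding D_def sum.distrib[symmetric] using c by (intro sum_mono) (auto simp: of_bool_def)
  have D_sym: "D s s' = D s' s" for s s' unfolding D_def by (simp add: eq_commute)
  \<comment> \<open>The infimum runs over points of \<open>K\<close> but measures distance between
    labels. Points sharing a label may differ in \<open>f\<close> by up to \<open>d\<close>, which
    is the error in the conclusion.\<close>
  define g where "g s = (INF y\<in>K. f y + D s (\<Phi> y))" for s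
  obtain y0 where y0: "y0 \<in> K" using ne by blast
  have lower: "f x - sum c I \<le> f y + D s (\<Phi> y)" for x y s
    using bdd[of x y] D_nonneg[of s "\<Phi> y"] by linarith
  have bb: "bdd_below ((\<lambda>y. f y + D s (\<Phi> y)) ` K)" for s
    by (rule bdd_belowI2[of _ "f y0 - sum c I"]) (rule lower)
  have g_le: "g s \<le> f y + D s (\<Phi> y)" if "y \<in> K" for s y
    unfolding g_def by (rule cINF_lower[OF bb that])
  have g_ge: "u \<le> g s" if "\<And>y. y \<in> K \<Longrightarrow> u \<le> f y + D s (\<Phi> y)" for u s
    unfolding g_def by (rule cINF_greatest[OF ne that])
  have le: "g s - D s s' \<le> g s'" for s s'
  proof (rule g_ge)
    fix y assume "y \<in> K"
    then show "g s - D s s' \<le> f y + D s' (\<Phi> y)"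
      using g_le[of y s] D_tri[of s "\<Phi> y" s'] by linarith
  qed
  show ?thesis
  proof (intro exI[of _ g] conjI ballI allI)
    show "hamming_lipschitz I c g"
      unfolding hamming_lipschitz_def D_def[symmetric]
    proof (intro allI)
      fix s s'
      show "\<bar>g s - g s'\<bar> \<le> D s s'" using le[of s s'] le[of s' s] D_sym[of s s'] by linarith
    qed
    fix x assume x: "x \<in> K"
    show "\<bar>f x - g (\<Phi> x)\<bar> \<le> d"
    proof -
      have "g (\<Phi> x) \<le> f x" using g_le[OF x, of "\<Phi> x"] by (simp add: D_def)
      moreover have "f x - d \<le> g (\<Phi> x)"
      proof (rule g_ge)
        fix y assume "y \<in> K"
        from lip[OF x this] show "f x - d \<le> f y + D (\<Phi> x) (\<Phi> y)" unfolding D_eq by linarith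
      qed
      ultimately show ?thesis by linarith
    qed
  next
    fix s x
    show "\<bar>g s - f x\<bar> \<le> 2 * sum c I"
    proof -
      have "f x - sum c I \<le> g s" by (rule g_ge) (rule lower)
      moreover have "g s \<le> f x + 2 * sum c I"
        using g_le[OF y0, of s] bdd[of y0 x] D_le[of s "\<Phi> y0"] by linarith
      moreover have "sum c I \<ge> 0" using bdd[of x x] by linarith
      ultimately show ?thesis by linarith
    qed
  qed
qed

text \<open>Points of \<open>K\<close> with equal labels in a coordinate are within \<rho> there.
  Taking \<open>J\<close> to be the coordinates whose labels differ, the compactness estimate makes
  \<open>f\<close> on \<open>K\<close> Lipschitz in the labels up to \<open>e\<close>, and the
  extension turns this into an exactly Lipschitz \<open>g\<close>.\<close>

lemma hamming_lipschitz_discretize: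
  fixes M :: "('i :: countable \<Rightarrow> 'b :: polish_space) measure" and f :: "('i \<Rightarrow> 'b) \<Rightarrow> real"
  assumes prob: "prob_space M" and sets: "sets M = sets borel" and f: "f \<in> borel_measurable borel"
    and lip: "hamming_lipschitz I c f" and I: "finite I" and c: "\<And>i. i \<in> I \<Longrightarrow> c i \<ge> 0" and e: "e > 0"
  shows "\<exists>\<phi> :: 'i \<Rightarrow> 'b \<Rightarrow> nat. \<exists>N g. (\<forall>i. \<phi> i \<in> measurable borel (count_space UNIV)) \<and>
      (\<forall>i z. \<phi> i z \<le> N) \<and> hamming_lipschitz I c g \<and> (\<forall>s x. \<bar>g s - f x\<bar> \<le> 2 * sum c I) \<and>
      measure M {x. \<bar>f x - g (\<lambda>i. if i \<in> I then \<phi> i (x i) else 0)\<bar> > e} \<le> e"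
proof -
  interpret prob_space M by fact
  have bdd: "\<bar>f x - f y\<bar> \<le> sum c I" for x y
    by (rule hamming_lipschitz_bound[OF lip I order_refl c]) auto
  \<comment> \<open>Keeping the excluded mass below 1 guarantees that \<open>K\<close> is non-empty,
    as the extension requires.\<close>
  define e' where "e' = min e (1 / 2)"
  have e': "e' > 0" "e' \<le> e" "e' < 1" using e by (auto simp: e'_def)
  obtain F where F: "finite F" "\<And>K. K \<in> F \<Longrightarrow> compact K"
    "\<And>K x y. K \<in> F \<Longrightarrow> x \<in> K \<Longrightarrow> y \<in> K \<Longrightarrow> \<bar>f x - f y\<bar> \<le> e / 2"
    "measure M (UNIV - \<Union>F) \<le> e'"
    using compact_level_family[OF prob sets f bdd half_gt_zero[OF e] e'(1)] by blast
  define K where "K = \<Union>F"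
  have K: "compact K" using F by (auto simp: K_def intro: compact_Union)
  have "K \<noteq> {}"
  proof
    assume "K = {}"
    then have "measure M UNIV \<le> e'" using F(4) by (simp only: K_def[symmetric] Diff_empty)
    moreover have "space M = UNIV" using sets_eq_imp_space_eq[OF sets] by simp
    ultimately show False using prob_space e' by simp
  qed
  \<comment> \<open>There are finitely many choices of \<open>K\<close>, \<open>K'\<close> and
    \<open>J\<close>, so a single \<rho> serves all of them.\<close>
  have "\<forall>\<^sub>F \<rho> in at_right 0. \<forall>K\<in>F. \<forall>K'\<in>F. \<forall>J\<in>Pow I. \<forall>x\<in>K. \<forall>y\<in>K'.
      (\<forall>i\<in>I - J. dist (x i) (y i) < \<rho>) \<longrightarrow> \<bar>f x - f y\<bar> \<le> sum c J + 2 * (e / 2)"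
    using F I c by (intro eventually_ball_finite ballI approx_lipschitz_compact[OF lip]) auto
  moreover have "\<forall>\<^sub>F \<rho>::real in at_right 0. \<rho> > 0" by (rule eventually_at_right_less)
  ultimately have "\<forall>\<^sub>F \<rho> in at_right 0. \<rho> > 0 \<and> (\<forall>K\<in>F. \<forall>K'\<in>F. \<forall>J\<in>Pow I. \<forall>x\<in>K. \<forall>y\<in>K'.
      (\<forall>i\<in>I - J. dist (x i) (y i) < \<rho>) \<longrightarrow> \<bar>f x - f y\<bar> \<le> sum c J + 2 * (e / 2))"
    by (rule eventually_conj[rotated])
  then obtain \<rho> where \<rho>: "\<rho> > 0" and \<rho>F: "\<forall>K\<in>F. \<forall>K'\<in>F. \<forall>J\<in>Pow I. \<forall>x\<in>K. \<forall>y\<in>K'.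
      (\<forall>i\<in>I - J. dist (x i) (y i) < \<rho>) \<longrightarrow> \<bar>f x - f y\<bar> \<le> sum c J + 2 * (e / 2)"
    using eventually_happens'[OF trivial_limit_at_right_real] by blast
  have \<rho>K: "\<bar>f x - f y\<bar> \<le> sum c J + e"
    if "J \<subseteq> I" "x \<in> K" "y \<in> K" "\<And>i. i \<in> I - J \<Longrightarrow> dist (x i) (y i) < \<rho>" for J x y
  proof -
    obtain K1 K2 where "K1 \<in> F" "x \<in> K1" "K2 \<in> F" "y \<in> K2"
      using \<open>x \<in> K\<close> \<open>y \<in> K\<close> by (auto simp: K_def)
    then have "\<bar>f x - f y\<bar> \<le> sum c J + 2 * (e / 2)"
      using \<rho>F that(1,4) by (metis PowI)
    then show ?thesis by simp
  qed
  have "\<exists>\<phi>. \<exists>N. \<phi> \<in> measurable borel (count_space UNIV) \<and> (\<forall>z. \<phi> z \<le> (N::nat)) \<and>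
      (\<forall>x\<in>(\<lambda>y. y i) ` K. \<forall>y\<in>(\<lambda>y. y i) ` K. \<phi> x = \<phi> y \<longrightarrow> dist x y < \<rho>)" for i
  proof -
    have "compact ((\<lambda>y. y i) ` K)"
      by (rule compact_continuous_image[OF continuous_on_subset[OF continuous_on_product_coordinates] K]) simp
    then show ?thesis using compact_cells[OF _ \<rho>] by metis
  qed
  then obtain \<phi> N where \<phi>: "\<And>i. \<phi> i \<in> measurable borel (count_space UNIV)" "\<And>i z. \<phi> i z \<le> (N i::nat)"
      "\<And>i x y. x \<in> (\<lambda>y. y i) ` K \<Longrightarrow> y \<in> (\<lambda>y. y i) ` K \<Longrightarrow> \<phi> i x = \<phi> i y \<Longrightarrow> dist x y < \<rho>"
    by metis
  \<comment> \<open>Trivial labels off the finite set \<open>I\<close> allow one bound on the labels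
    for all coordinates.\<close>
  define \<psi> where "\<psi> i = (if i \<in> I then \<phi> i else (\<lambda>_. 0))" for i
  define \<Phi> where "\<Phi> x i = (if i \<in> I then \<psi> i (x i) else 0)" for x i
  have lipK: "\<bar>f x - f y\<bar> \<le> sum c {i \<in> I. \<Phi> x i \<noteq> \<Phi> y i} + e" if "x \<in> K" "y \<in> K" for x y
    by (rule \<rho>K) (use that in \<open>auto simp: \<Phi>_def \<psi>_def intro!: \<phi>(3)\<close>)
  have "\<exists>g. hamming_lipschitz I c g \<and> (\<forall>x\<in>K. \<bar>f x - g (\<Phi> x)\<bar> \<le> e) \<and>
      (\<forall>s x. \<bar>g s - f x\<bar> \<le> 2 * sum c I)"
    by (rule hamming_lipschitz_extension) (rule I, erule c, rule \<open>K \<noteq> {}\<close>, rule bdd, erule (1) lipK)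
  then obtain g where g: "hamming_lipschitz I c g" "\<forall>x\<in>K. \<bar>f x - g (\<Phi> x)\<bar> \<le> e"
    "\<forall>s x. \<bar>g s - f x\<bar> \<le> 2 * sum c I"
    by (elim exE conjE)
  have K_sets: "K \<in> sets M" using K by (simp add: sets borel_closed compact_imp_closed)
  show ?thesis
  proof (intro exI[of _ \<psi>] exI[of _ "Max (N ` I)"] exI[of _ g] conjI allI)
    show "\<psi> i \<in> measurable borel (count_space UNIV)" for i
      using \<phi>(1)[of i] by (simp add: \<psi>_def)
    show "\<psi> i z \<le> Max (N ` I)" for i z
      using I \<phi>(2)[of i z] by (auto simp: \<psi>_def intro: order_trans[OF _ Max_ge])
    have "measure M {x. \<bar>f x - g (\<Phi> x)\<bar> > e} \<le> measure M (UNIV - \<Union>F)"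
      using g(2) K_sets by (intro finite_measure_mono) (force simp: K_def sets)+
    then show "measure M {x. \<bar>f x - g (\<lambda>i. if i \<in> I then \<psi> i (x i) else 0)\<bar> > e} \<le> e"
      using F(4) e' by (simp add: \<Phi>_def[abs_def])
    show "\<bar>g s - f x\<bar> \<le> 2 * sum c I" for s x using g(3) by simp
    show "hamming_lipschitz I c g" by (rule g(1))
  qed
qed

section \<open>Polish topologies as measurable retracts of the sequence space\<close>

lemma space_borel_of [simp]: "space (borel_of X) = topspace X"
  by (auto simp: borel_of_def openin_subset space_measure_of_conv)

lemma openin_sets_borel_of: "openin X U \<Longrightarrow> U \<in> sets (borel_of X)"
  unfolding borel_of_def by (subst sets_measure_of) (auto dest: openin_subset)

lemma measurable_borel_ofI:
  assumes "\<And>U. openin X U \<Longrightarrow> f -` U \<inter> space M \<in> sets M"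
    and "\<And>x. x \<in> space M \<Longrightarrow> f x \<in> topspace X"
  shows "f \<in> measurable M (borel_of X)"
  unfolding borel_of_def
  by (rule measurable_measure_of) (use assms in \<open>auto dest: openin_subset\<close>)

text \<open>With \<open>D\<close> dense, \<open>x \<mapsto> (d x (D k))\<^sub>k\<close> embeds the space into the sequence space, and its image
  consists of the sequences \<open>y\<close> with \<open>y k - y l \<le> d (D k) (D l) \<le> y k + y l\<close> and \<open>inf y = 0\<close>:
  completeness turns such a \<open>y\<close> into the distances from an actual point.\<close>

lemma (in Metric_space) distance_sequences:
  assumes complete: "mcomplete" and D: "\<And>k. D k \<in> M"
    and le: "\<And>k l. d (D k) (D l) \<le> y k + y l" and ge: "\<And>k l. y k - y l \<le> d (D k) (D l)"
    and small: "\<And>m. \<exists>k. y k < 1 / real (Suc m)"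
  shows "\<exists>x\<in>M. \<forall>k. d x (D k) = y k"
proof -
  obtain \<kappa> where \<kappa>: "\<And>m. y (\<kappa> m) < 1 / real (Suc m)" using small by metis
  have pos: "0 \<le> y k" for k using le[of k k] D by simp
  have \<kappa>0: "(\<lambda>m. y (\<kappa> m)) \<longlonglongrightarrow> 0"
    by (rule tendsto_sandwich[OF _ _ tendsto_const LIMSEQ_inverse_real_of_nat])
       (use pos \<kappa> in \<open>auto simp: less_imp_le field_simps intro!: always_eventually\<close>)
  have "MCauchy (\<lambda>m. D (\<kappa> m))"
    unfolding MCauchy_def
  proof (intro conjI allI impI)
    fix e :: real assume "e > 0"
    then have "\<forall>\<^sub>F m in sequentially. y (\<kappa> m) < e / 2"
      using order_tendstoD(2)[OF \<kappa>0, of "e / 2"] by simp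
    then obtain N where N: "\<And>m. N \<le> m \<Longrightarrow> y (\<kappa> m) < e / 2"
      by (auto simp: eventually_sequentially)
    show "\<exists>N. \<forall>n n'. N \<le> n \<longrightarrow> N \<le> n' \<longrightarrow> d (D (\<kappa> n)) (D (\<kappa> n')) < e"
    proof (intro exI[of _ N] allI impI)
      fix n n' assume "N \<le> n" "N \<le> n'"
      then show "d (D (\<kappa> n)) (D (\<kappa> n')) < e"
        using N[of n] N[of n'] le[of "\<kappa> n" "\<kappa> n'"] by linarith
    qed
  qed (use D in auto)
  then obtain x where x: "limitin mtopology (\<lambda>m. D (\<kappa> m)) x sequentially"
    using complete unfolding mcomplete_def by blast
  then have xM: "x \<in> M" by (rule limitin_mspace)
  have dx: "(\<lambda>m. d (D (\<kappa> m)) x) \<longlonglongrightarrow> 0"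
  proof (rule LIMSEQ_I)
    fix e :: real assume "e > 0"
    then have "\<forall>\<^sub>F m in sequentially. D (\<kappa> m) \<in> M \<and> d (D (\<kappa> m)) x < e"
      using x by (simp add: limitin_metric)
    then show "\<exists>N. \<forall>m\<ge>N. norm (d (D (\<kappa> m)) x - 0) < e"
      by (auto simp: eventually_sequentially)
  qed
  have "d x (D k) = y k" for k
  proof -
    \<comment> \<open>Comparison through \<open>D (\<kappa> m)\<close>: its distance to
      \<open>x\<close> and the value \<open>y (\<kappa> m)\<close> both tend to 0.\<close>
    have "\<bar>d x (D k) - y k\<bar> \<le> d (D (\<kappa> m)) x + y (\<kappa> m)" for m
      using triangle[of x "D (\<kappa> m)" "D k"] triangle[of "D (\<kappa> m)" x "D k"]
        le[of "\<kappa> m" k] ge[of k "\<kappa> m"] D xM commute[of x "D (\<kappa> m)"]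
        commute[of "D k" "D (\<kappa> m)"] by auto
    moreover have "(\<lambda>m. d (D (\<kappa> m)) x + y (\<kappa> m)) \<longlonglongrightarrow> 0 + 0"
      by (rule tendsto_add[OF dx \<kappa>0])
    ultimately have "\<bar>d x (D k) - y k\<bar> \<le> 0 + 0"
      by (intro LIMSEQ_le_const) auto
    then show ?thesis by simp
  qed
  then show ?thesis using xM by blast
qed

text \<open>Moves coordinates from different abstract topologies into the single Polish type
  \<open>nat \<Rightarrow> real\<close>, with \<open>R\<close> pulling functions back. Non-emptiness
  gives \<open>R\<close> a value off the image.\<close>

lemma polish_measurable_section:
  assumes polish: "polish_topology X" and ne: "topspace X \<noteq> {}"
  obtains \<Phi> :: "'a \<Rightarrow> nat \<Rightarrow> real" and R
  where "\<Phi> \<in> borel_measurable (borel_of X)" "R \<in> measurable borel (borel_of X)"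
    "\<And>x. x \<in> topspace X \<Longrightarrow> R (\<Phi> x) = x"
proof -
  obtain M d where Md: "Metric_space M d" "Metric_space.mcomplete M d"
    and X: "X = Metric_space.mtopology M d"
    using polish unfolding polish_topology_def completely_metrizable_space_def by blast
  interpret Metric_space M d by fact
  have M: "topspace X = M" by (simp add: X)
  obtain C where C: "countable C" "C \<subseteq> M" "mtopology closure_of C = M"
    using polish unfolding polish_topology_def M by (auto simp: X)
  have "C \<noteq> {}" using C ne M by auto
  define D where "D = from_nat_into C"
  have D: "D k \<in> M" for k using C \<open>C \<noteq> {}\<close> from_nat_into[of C k] by (auto simp: D_def)
  have dense: "\<exists>k. d x (D k) < e" if "x \<in> M" "e > 0" for x e
  proof -
    have "x \<in> mtopology closure_of C" using that C by simp
    then obtain y where "y \<in> C" "y \<in> mball x e" using \<open>e > 0\<close> unfolding metric_closure_of by blast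
    moreover obtain k where "D k = y"
      using from_nat_into_surj[OF C(1) \<open>y \<in> C\<close>] by (auto simp: D_def)
    ultimately show ?thesis by auto
  qed
  define \<Phi> where "\<Phi> x k = d x (D k)" for x k
  define S where "S = {y. (\<forall>k l. d (D k) (D l) \<le> y k + y l) \<and> (\<forall>k l. y k - y l \<le> d (D k) (D l))
      \<and> (\<forall>m. \<exists>k. y k < 1 / real (Suc m))}"
  \<comment> \<open>Only countably many conditions on coordinates occur, so the image of the
    embedding is Borel.\<close>
  have S_borel: "S \<in> sets borel"
    unfolding S_def by measurable
  have S: "S = \<Phi> ` M"
  proof (intro equalityI subsetI)
    fix y assume "y \<in> S"
    then have "\<exists>x\<in>M. \<forall>k. d x (D k) = y k"
      by (intro distance_sequences Md D) (auto simp: S_def simp del: of_nat_Suc)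
    then obtain x where "x \<in> M" "\<And>k. d x (D k) = y k" by blast
    then have "\<Phi> x = y" by (auto simp: \<Phi>_def)
    then show "y \<in> \<Phi> ` M" using \<open>x \<in> M\<close> by blast
  next
    fix y assume "y \<in> \<Phi> ` M"
    then obtain x where x: "x \<in> M" "y = \<Phi> x" by blast
    have "d (D k) (D l) \<le> y k + y l" "y k - y l \<le> d (D k) (D l)" for k l
      using triangle[of "D k" x "D l"] triangle[of x "D l" "D k"] x D
        commute[of x "D k"] commute[of "D l" "D k"] by (auto simp: \<Phi>_def)
    moreover have "\<exists>k. y k < 1 / real (Suc m)" for m
      using dense[OF x(1), of "1 / real (Suc m)"] x by (simp add: \<Phi>_def)
    ultimately show "y \<in> S" by (auto simp: S_def)
  qed
  have inj: "x = x'" if x: "x \<in> M" and x': "x' \<in> M" and eq: "\<Phi> x = \<Phi> x'" for x x'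
  proof (rule ccontr)
    assume "x \<noteq> x'"
    then have "d x x' / 2 > 0" using x x' by simp
    then obtain k where k: "d x (D k) < d x x' / 2" using dense[OF x] by blast
    moreover have "d x' (D k) = d x (D k)" using fun_cong[OF eq, of k] by (simp add: \<Phi>_def)
    moreover have "d x x' \<le> d x (D k) + d x' (D k)"
      using triangle[of x "D k" x'] x x' D commute[of x' "D k"] by simp
    ultimately show False by linarith
  qed
  obtain x0 where x0: "x0 \<in> M" using ne M by auto
  define R where "R y = (if y \<in> S then inv_into M \<Phi> y else x0)" for y
  have R\<Phi>: "R (\<Phi> x) = x" if "x \<in> M" for x
    using that inj by (auto simp: R_def S inv_into_f_f inj_on_def)
  have RM: "R y \<in> M" for y
    using x0 by (auto simp: R_def S inv_into_into)
  have R_open: "\<Phi> ` U \<in> sets borel" if U: "openin X U" for U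
  proof -
    \<comment> \<open>An open set is a countable union of balls with centres \<open>D k\<close> and
      rational radii, and in the image each such ball is a condition on one coordinate.\<close>
    define B where "B = {(k, r :: rat). mball (D k) (of_rat r) \<subseteq> U}"
    have UM: "U \<subseteq> M" using openin_subset[OF U] M by simp
    have "\<Phi> ` U = S \<inter> (\<Union>(k, r)\<in>B. {y. y k < of_rat r})"
    proof (intro equalityI subsetI)
      fix y assume "y \<in> \<Phi> ` U"
      then obtain x where x: "x \<in> U" "y = \<Phi> x" by blast
      then obtain e where e: "e > 0" "mball x e \<subseteq> U" using U by (auto simp: X openin_mtopology)
      obtain r where r: "0 < real_of_rat r" "real_of_rat r < e / 2"
        using of_rat_dense[of 0 "e / 2"] e by auto
      obtain k where k: "d x (D k) < of_rat r" using dense[of x "of_rat r"] x UM r by auto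
      have "mball (D k) (of_rat r) \<subseteq> mball x e"
      proof
        fix z assume "z \<in> mball (D k) (of_rat r)"
        then show "z \<in> mball x e"
          using triangle[of x "D k" z] k r x UM by auto
      qed
      then have "(k, r) \<in> B" using e by (auto simp: B_def)
      moreover have "y k < of_rat r" using k x by (simp add: \<Phi>_def)
      moreover have "y \<in> S" using x UM by (auto simp: S)
      ultimately show "y \<in> S \<inter> (\<Union>(k, r)\<in>B. {y. y k < of_rat r})" by blast
    next
      fix y assume "y \<in> S \<inter> (\<Union>(k, r)\<in>B. {y. y k < of_rat r})"
      then obtain x k r where "x \<in> M" "y = \<Phi> x" "(k, r) \<in> B" "y k < of_rat r"
        by (auto simp: S)
      then have "x \<in> mball (D k) (of_rat r)" "mball (D k) (of_rat r) \<subseteq> U"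
        using D commute[of x "D k"] by (auto simp: B_def \<Phi>_def)
      then show "y \<in> \<Phi> ` U" using \<open>y = \<Phi> x\<close> by blast
    qed
    moreover have "(\<Union>(k, r)\<in>B. {y :: nat \<Rightarrow> real. y k < of_rat r}) \<in> sets borel"
      by (intro sets.countable_UN'') (auto split: prod.split)
    ultimately show ?thesis using S_borel by auto
  qed
  show ?thesis
  proof
    show "\<Phi> \<in> borel_measurable (borel_of X)"
    proof (rule measurable_coordinatewise_then_product)
      fix k
      show "(\<lambda>x. \<Phi> x k) \<in> borel_measurable (borel_of X)"
      proof (rule borel_measurable_iff_less[THEN iffD2], rule allI)
        fix a
        have "{x \<in> space (borel_of X). \<Phi> x k < a} = mball (D k) a"
          using D commute[of _ "D k"] by (auto simp: M \<Phi>_def)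
        then show "{x \<in> space (borel_of X). \<Phi> x k < a} \<in> sets (borel_of X)"
          by (simp add: openin_sets_borel_of X)
      qed
    qed
    show "R \<in> measurable borel (borel_of X)"
    proof (rule measurable_borel_ofI)
      fix U assume U: "openin X U"
      have UM: "U \<subseteq> M" using openin_subset[OF U] M by simp
      have "R -` U \<inter> space borel = \<Phi> ` U \<union> (if x0 \<in> U then - S else {})"
      proof (intro equalityI subsetI)
        fix y assume y: "y \<in> R -` U \<inter> space borel"
        show "y \<in> \<Phi> ` U \<union> (if x0 \<in> U then - S else {})"
        proof (cases "y \<in> S")
          case True
          then obtain x where "x \<in> M" "y = \<Phi> x" by (auto simp: S)
          then show ?thesis using y R\<Phi> by auto
        next
          case False
          then show ?thesis using y by (auto simp: R_def)
        qed
      next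
        fix y assume "y \<in> \<Phi> ` U \<union> (if x0 \<in> U then - S else {})"
        then consider x where "x \<in> U" "y = \<Phi> x" | "x0 \<in> U" "y \<notin> S"
          by (auto split: if_splits)
        then show "y \<in> R -` U \<inter> space borel"
        proof cases
          case 1
          then show ?thesis using R\<Phi> UM by auto
        next
          case 2
          then show ?thesis by (simp add: R_def)
        qed
      qed
      then show "R -` U \<inter> space borel \<in> sets borel"
        using R_open[OF U] S_borel by auto
    qed (use RM M in auto)
    show "R (\<Phi> x) = x" if "x \<in> topspace X" for x
      using R\<Phi> that M by simp
  qed
qed

section \<open>The tail bound\<close>

text \<open>A pmf must almost surely sit on atoms of positive mass; with finitely many values, those
  of mass 0 can be discarded together.\<close>

lemma simple_law_pmf:
  assumes "prob_space P" and Y: "Y \<in> measurable P (count_space UNIV)" and fin: "finite (Y ` space P)"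
  obtains q where "measure_pmf q = distr P (count_space UNIV) Y" "finite (set_pmf q)"
proof -
  interpret prob_space P by fact
  let ?D = "distr P (count_space UNIV) Y"
  have meas: "measure ?D {y} = prob (Y -` {y} \<inter> space P)" for y
    using Y by (simp add: measure_distr)
  have "AE \<omega> in P. \<forall>y\<in>Y ` space P. Y \<omega> = y \<longrightarrow> measure ?D {y} \<noteq> 0"
  proof (rule AE_finite_allI[OF fin])
    fix y
    show "AE \<omega> in P. Y \<omega> = y \<longrightarrow> measure ?D {y} \<noteq> 0"
    proof (cases "measure ?D {y} = 0")
      case True
      have "Y -` {y} \<inter> space P \<in> sets P" using Y by (rule measurable_sets) simp
      then have "Y -` {y} \<inter> space P \<in> null_sets P"
        using True meas by (intro null_setsI) (simp_all add: emeasure_eq_measure)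
      then have "AE \<omega> in P. \<omega> \<notin> Y -` {y} \<inter> space P" by (rule AE_not_in)
      moreover have "AE \<omega> in P. \<omega> \<in> space P" by (rule AE_space)
      ultimately show ?thesis by eventually_elim auto
    qed simp
  qed
  moreover have "AE \<omega> in P. \<omega> \<in> space P" by (rule AE_space)
  ultimately have "AE \<omega> in P. measure ?D {Y \<omega>} \<noteq> 0" by eventually_elim auto
  then have "AE y in ?D. measure ?D {y} \<noteq> 0" using Y by (subst AE_distr_iff) auto
  then have q: "measure_pmf (Abs_pmf ?D) = ?D"
    using prob_space_distr[OF Y] by (intro Abs_pmf_inverse) simp
  have "set_pmf (Abs_pmf ?D) \<subseteq> Y ` space P"
  proof
    fix y assume "y \<in> set_pmf (Abs_pmf ?D)"
    then have "prob (Y -` {y} \<inter> space P) \<noteq> 0"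
      using meas[of y] by (simp add: set_pmf.rep_eq q)
    then have "Y -` {y} \<inter> space P \<noteq> {}" by (metis measure_empty)
    then show "y \<in> Y ` space P" by auto
  qed
  then show ?thesis using that[OF q] finite_subset[OF _ fin] by blast
qed

text \<open>Chernoff's bound with \<open>l\<close> left free: the discretisation error is sent to 0
  at fixed \<open>l\<close>, and only then is the exponent optimised.\<close>

lemma rooted_tree_tail_pmf:
  fixes f :: "('v \<Rightarrow> 'b) \<Rightarrow> real"
  assumes "rooted_tree r V E" and l: "l > 0"
    and "\<And>i. i \<in> V \<Longrightarrow> c i \<ge> 0" and fin: "finite (set_pmf q)"
    and "pmf_graph_dependent q V E" and "hamming_lipschitz V c f"
  shows "measure q {x. s \<le> f x - measure_pmf.expectation q f}
         \<le> exp (l\<^sup>2 * ((c r)\<^sup>2 + (\<Sum>e\<in>E. (sum c e)\<^sup>2)) / 8 - l * s)"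
proof -
  let ?\<mu> = "measure_pmf.expectation q f" and ?A = "{x. s \<le> f x - measure_pmf.expectation q f}"
  have "indicator ?A x \<le> exp (- (l * s)) * exp (l * (f x - ?\<mu>))" for x
  proof (cases "x \<in> ?A")
    case True
    then have "l * s \<le> l * (f x - ?\<mu>)" using l by (intro mult_left_mono) auto
    then show ?thesis using True by (simp flip: exp_add)
  qed simp
  then have "measure_pmf.expectation q (indicator ?A)
      \<le> measure_pmf.expectation q (\<lambda>x. exp (- (l * s)) * exp (l * (f x - ?\<mu>)))"
    by (intro integral_mono integrable_measure_pmf_finite fin)
  also have "\<dots> = exp (- (l * s)) * measure_pmf.expectation q (\<lambda>x. exp (l * (f x - ?\<mu>)))"
    by simp
  also have "\<dots> \<le> exp (- (l * s)) * exp (l\<^sup>2 * ((c r)\<^sup>2 + (\<Sum>e\<in>E. (sum c e)\<^sup>2)) / 8)"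
    by (rule mult_left_mono[OF rooted_tree_mgf[OF assms]]) auto
  finally show ?thesis by (simp flip: exp_add)
qed

text \<open>The discretised function differs from \<open>f\<close> by at most \<open>e\<close> off an event of probability \<open>e\<close>
  and by at most \<open>2 * sum c I\<close> on it, which moves the mean by at most \<open>e + 2 * sum c I * e\<close>.\<close>

lemma rooted_tree_tail_polish:
  fixes X :: "'i :: countable \<Rightarrow> 'w \<Rightarrow> 'b :: polish_space" and f :: "('i \<Rightarrow> 'b) \<Rightarrow> real"
  assumes prob: "prob_space P" and X: "\<And>i. X i \<in> borel_measurable P"
    and f: "f \<in> borel_measurable borel" and lip: "hamming_lipschitz I c f"
    and tree: "rooted_tree r I E" and c: "\<And>i. i \<in> I \<Longrightarrow> c i \<ge> 0" and l: "l > 0"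
    and dep: "\<And>S T A. S \<subseteq> I \<Longrightarrow> T \<subseteq> I \<Longrightarrow> S \<inter> T = {} \<Longrightarrow> \<forall>i\<in>S. \<forall>j\<in>T. {i, j} \<notin> E \<Longrightarrow>
        (\<And>i. A i \<in> sets borel) \<Longrightarrow>
        measure P {\<omega> \<in> space P. \<forall>i\<in>S \<union> T. X i \<omega> \<in> A i}
        = measure P {\<omega> \<in> space P. \<forall>i\<in>S. X i \<omega> \<in> A i} * measure P {\<omega> \<in> space P. \<forall>i\<in>T. X i \<omega> \<in> A i}"
  shows "measure P {\<omega> \<in> space P. t \<le> f (\<lambda>i. X i \<omega>) - prob_space.expectation P (\<lambda>\<omega>. f (\<lambda>i. X i \<omega>))}
      \<le> exp (l\<^sup>2 * ((c r)\<^sup>2 + (\<Sum>e\<in>E. (sum c e)\<^sup>2)) / 8 - l * t)"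
proof -
  interpret prob_space P by fact
  define C where "C = sum c I"
  define V where "V = (c r)\<^sup>2 + (\<Sum>e\<in>E. (sum c e)\<^sup>2)"
  have I: "finite I" using rooted_tree_finite[OF tree] by simp
  have C: "C \<ge> 0" unfolding C_def by (rule sum_nonneg[OF c])
  define X' where "X' \<omega> i = X i \<omega>" for \<omega> i
  have X' [measurable]: "X' \<in> borel_measurable P"
    using X by (intro measurable_coordinatewise_then_product) (simp add: X'_def)
  have f [measurable]: "f \<in> borel_measurable borel" by (rule f)
  let ?f = "\<lambda>\<omega>. f (X' \<omega>)"
  have fX: "?f \<in> borel_measurable P" by measurable
  have bdd: "\<bar>f x - f y\<bar> \<le> C" for x y
    unfolding C_def by (rule hamming_lipschitz_bound[OF lip I order_refl c]) auto
  have int_f: "integrable P ?f"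
  proof (rule integrable_const_bound[of _ "\<bar>f undefined\<bar> + C"])
    have "norm (f x) \<le> \<bar>f undefined\<bar> + C" for x
      using bdd[of x undefined] by auto
    then show "AE \<omega> in P. norm (?f \<omega>) \<le> \<bar>f undefined\<bar> + C" by (intro always_eventually) simp
  qed (rule fX)
  let ?A = "{\<omega> \<in> space P. t \<le> ?f \<omega> - expectation ?f}"
  have approx: "prob ?A \<le> e + exp (l\<^sup>2 * V / 8 - l * (t - e - (e + 2 * C * e)))" if e: "e > 0" for e
  proof -
    let ?M = "distr P borel X'"
    have M: "prob_space ?M" "sets ?M = sets borel" by (auto intro: prob_space_distr)
    have "\<exists>\<phi> :: 'i \<Rightarrow> 'b \<Rightarrow> nat. \<exists>N g. (\<forall>i. \<phi> i \<in> measurable borel (count_space UNIV)) \<and>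
      (\<forall>i z. \<phi> i z \<le> N) \<and> hamming_lipschitz I c g \<and> (\<forall>s x. \<bar>g s - f x\<bar> \<le> 2 * sum c I) \<and>
      measure ?M {x. \<bar>f x - g (\<lambda>i. if i \<in> I then \<phi> i (x i) else 0)\<bar> > e} \<le> e"
      by (rule hamming_lipschitz_discretize[OF M f lip I _ e]) (rule c)
    then obtain \<phi> :: "'i \<Rightarrow> 'b \<Rightarrow> nat" and N g
      where \<phi>: "\<forall>i. \<phi> i \<in> measurable borel (count_space UNIV)" "\<forall>i z. \<phi> i z \<le> N"
        and g: "hamming_lipschitz I c g" "\<forall>s x. \<bar>g s - f x\<bar> \<le> 2 * sum c I"
        and close: "measure ?M {x. \<bar>f x - g (\<lambda>i. if i \<in> I then \<phi> i (x i) else 0)\<bar> > e} \<le> e"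
      by (elim exE conjE)
    define \<Phi> where "\<Phi> x i = (if i \<in> I then \<phi> i (x i) else 0)" for x i
    define Y where "Y \<omega> = \<Phi> (X' \<omega>)" for \<omega>
    define R where "R = {y :: 'i \<Rightarrow> nat. \<forall>i. (i \<in> I \<longrightarrow> y i \<in> {..N}) \<and> (i \<notin> I \<longrightarrow> y i = 0)}"
    have finR: "finite R" unfolding R_def by (rule finite_set_of_finite_funs) (use I in auto)
    have \<Phi>R: "\<Phi> x \<in> R" for x using \<phi>(2) by (auto simp: R_def \<Phi>_def)
    have \<phi>_sets: "\<phi> i -` {k} \<in> sets borel" for i k
      using measurable_sets[OF \<phi>(1)[rule_format, of i], of "{k}"] by simp
    have \<Phi>_vimage: "\<Phi> -` {y} \<in> sets borel" if "y \<in> R" for y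
    proof -
      have "\<Phi> -` {y} = (\<Inter>i\<in>I. {x. x i \<in> \<phi> i -` {y i}})"
        using that by (auto simp: \<Phi>_def R_def fun_eq_iff)
      also have "\<dots> \<in> sets borel"
      proof (cases "I = {}")
        case False
        have "{x. x i \<in> \<phi> i -` {y i}} \<in> sets borel" for i
          using measurable_sets[OF measurable_product_coordinates[of i] \<phi>_sets[of i "y i"]]
          by (simp add: vimage_def)
        then show ?thesis using False I by (intro sets.finite_INT) auto
      qed simp
      finally show ?thesis .
    qed
    have \<Phi>: "\<Phi> \<in> measurable borel (count_space UNIV)"
    proof (rule measurableI)
      fix A :: "('i \<Rightarrow> nat) set"
      have "\<Phi> -` A \<inter> space borel = (\<Union>y\<in>A \<inter> R. \<Phi> -` {y})" using \<Phi>R by auto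
      also have "\<dots> \<in> sets borel" using finR \<Phi>_vimage by (intro sets.finite_UN) auto
      finally show "\<Phi> -` A \<inter> space borel \<in> sets borel" .
    qed simp
    have Y: "Y \<in> measurable P (count_space UNIV)"
      unfolding Y_def using measurable_compose[OF X' \<Phi>] by simp
    have "finite (Y ` space P)" by (rule finite_subset[OF _ finR]) (use \<Phi>R in \<open>auto simp: Y_def\<close>)
    then obtain q where q: "measure_pmf q = distr P (count_space UNIV) Y" "finite (set_pmf q)"
      by (rule simple_law_pmf[OF prob Y])
    have q_meas: "measure q A = prob {\<omega> \<in> space P. Y \<omega> \<in> A}" for A
      using Y by (simp add: q measure_distr vimage_def Int_def conj_commute)
    have q_exp: "measure_pmf.expectation q h = expectation (\<lambda>\<omega>. h (Y \<omega>))" for h :: "('i \<Rightarrow> nat) \<Rightarrow> real"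
      using Y by (simp add: q integral_distr)
    have "pmf_graph_dependent q I E"
      unfolding pmf_graph_dependent_def
    proof (intro allI impI)
      fix S T x
      assume ST: "S \<subseteq> I" "T \<subseteq> I" "S \<inter> T = {}" "\<forall>i\<in>S. \<forall>j\<in>T. {i, j} \<notin> E"
      \<comment> \<open>Prescribing labels on \<open>U\<close> is a product event for
        \<open>X\<close>, with factors the label cells, so \<open>dep\<close> applies to it.\<close>
      have eq: "measure q {y. \<forall>i\<in>U. y i = x i} = prob {\<omega> \<in> space P. \<forall>i\<in>U. X i \<omega> \<in> \<phi> i -` {x i}}"
        if "U \<subseteq> I" for U
        unfolding q_meas using that
        by (intro arg_cong[where f = prob]) (auto simp: Y_def \<Phi>_def X'_def subset_iff)
      show "measure q {y. \<forall>i\<in>S \<union> T. y i = x i}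
        = measure q {y. \<forall>i\<in>S. y i = x i} * measure q {y. \<forall>i\<in>T. y i = x i}"
        unfolding eq[OF ST(1)] eq[OF ST(2)] eq[OF Un_least[OF ST(1,2)]]
        by (rule dep[OF ST \<phi>_sets])
    qed
    from rooted_tree_tail_pmf[OF tree l c q(2) this g(1), of "t - e - (e + 2 * C * e)"]
    have tail: "prob {\<omega> \<in> space P. t - e - (e + 2 * C * e) \<le> g (Y \<omega>) - expectation (\<lambda>\<omega>. g (Y \<omega>))}
        \<le> exp (l\<^sup>2 * V / 8 - l * (t - e - (e + 2 * C * e)))"
      unfolding q_meas q_exp V_def by simp
    have gY: "(\<lambda>\<omega>. g (Y \<omega>)) \<in> borel_measurable P"
      using measurable_compose[OF Y, of g borel] by simp
    let ?B = "{\<omega> \<in> space P. e < \<bar>?f \<omega> - g (Y \<omega>)\<bar>}"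
    have B: "?B \<in> events" using fX gY by measurable
    have "(\<lambda>x. g (\<Phi> x)) \<in> borel_measurable borel"
      using measurable_compose[OF \<Phi>, of g borel] by simp
    then have "{x. \<bar>f x - g (\<Phi> x)\<bar> > e} \<in> sets borel" by measurable
    then have "prob ?B = measure ?M {x. \<bar>f x - g (\<Phi> x)\<bar> > e}"
      by (subst measure_distr) (auto simp: Y_def intro!: arg_cong[where f = prob])
    also have "\<dots> \<le> e" using close by (simp add: \<Phi>_def[abs_def])
    finally have prob_B: "prob ?B \<le> e" .
    have diff: "\<bar>g s - f x\<bar> \<le> 2 * C" for s x using g(2) by (simp add: C_def)
    have int_g: "integrable P (\<lambda>\<omega>. g (Y \<omega>))"
    proof (rule integrable_const_bound[of _ "\<bar>f undefined\<bar> + 2 * C"])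
      have "norm (g s) \<le> \<bar>f undefined\<bar> + 2 * C" for s
        using diff[of s undefined] by auto
      then show "AE \<omega> in P. norm (g (Y \<omega>)) \<le> \<bar>f undefined\<bar> + 2 * C" by (intro always_eventually) simp
    qed (rule gY)
    have "expectation (\<lambda>\<omega>. g (Y \<omega>)) - expectation ?f = expectation (\<lambda>\<omega>. g (Y \<omega>) - ?f \<omega>)"
      using int_f int_g by simp
    also have "\<dots> \<le> expectation (\<lambda>\<omega>. e + 2 * C * indicator ?B \<omega>)"
    proof (rule integral_mono)
      show "integrable P (\<lambda>\<omega>. g (Y \<omega>) - ?f \<omega>)" using int_f int_g by simp
      show "integrable P (\<lambda>\<omega>. e + 2 * C * indicator ?B \<omega>)"
        using B by (intro Bochner_Integration.integrable_add integrable_mult_right)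
          (auto simp: emeasure_eq_measure)
      show "g (Y \<omega>) - ?f \<omega> \<le> e + 2 * C * indicator ?B \<omega>" if "\<omega> \<in> space P" for \<omega>
        using that diff[of "Y \<omega>" "X' \<omega>"] e by (auto simp: indicator_def)
    qed
    also have "\<dots> = e + 2 * C * prob ?B"
      using B by (simp add: prob_space emeasure_eq_measure)
    also have "\<dots> \<le> e + 2 * C * e"
      using prob_B C by (intro add_left_mono mult_left_mono) auto
    finally have mean: "expectation (\<lambda>\<omega>. g (Y \<omega>)) \<le> expectation ?f + (e + 2 * C * e)" by linarith
    let ?G = "{\<omega> \<in> space P. t - e - (e + 2 * C * e) \<le> g (Y \<omega>) - expectation (\<lambda>\<omega>. g (Y \<omega>))}"
    have G: "?G \<in> events" using gY by measurable
    \<comment> \<open>Off \<open>?B\<close>, passing from \<open>f\<close> to \<open>g\<close> costs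
      \<open>e\<close> in the value and at most \<open>e + 2 * C * e\<close> in the mean, hence the
      lowered threshold in \<open>?G\<close>.\<close>
    have "prob ?A \<le> prob (?B \<union> ?G)"
    proof (rule finite_measure_mono)
      show "?A \<subseteq> ?B \<union> ?G"
      proof
        fix \<omega> assume \<omega>: "\<omega> \<in> ?A"
        show "\<omega> \<in> ?B \<union> ?G"
        proof (cases "\<omega> \<in> ?B")
          case False
          then have "?f \<omega> - e \<le> g (Y \<omega>)" using \<omega> by auto
          then show ?thesis using \<omega> mean by auto
        qed simp
      qed
    qed (use B G in blast)
    also have "\<dots> \<le> prob ?B + prob ?G" using B G by (rule measure_Un_le)
    also have "\<dots> \<le> e + exp (l\<^sup>2 * V / 8 - l * (t - e - (e + 2 * C * e)))"
      using prob_B tail by (rule add_mono)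
    finally show ?thesis .
  qed
  have "((\<lambda>e. e + exp (l\<^sup>2 * V / 8 - l * (t - e - (e + 2 * C * e)))) \<longlongrightarrow>
      0 + exp (l\<^sup>2 * V / 8 - l * (t - 0 - (0 + 2 * C * 0)))) (at_right 0)"
    by (intro tendsto_intros)
  then have "prob ?A \<le> 0 + exp (l\<^sup>2 * V / 8 - l * (t - 0 - (0 + 2 * C * 0)))"
  proof (rule tendsto_lowerbound)
    show "\<forall>\<^sub>F e in at_right 0. prob ?A \<le> e + exp (l\<^sup>2 * V / 8 - l * (t - e - (e + 2 * C * e)))"
      by (rule eventually_at_rightI[of 0 1]) (use approx in auto)
  qed simp
  then show ?thesis by (simp add: V_def X'_def[abs_def])
qed

section \<open>Optimising the exponent, and the passage to abstract Polish topologies\<close>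

lemma exp_tail_optimize:
  assumes t: "t > 0" and D: "D \<ge> 0"
    and le: "\<And>l. l > 0 \<Longrightarrow> p \<le> exp (l\<^sup>2 * D / 8 - l * t)"
  shows "p \<le> gauss_tail D t"
proof (cases "D = 0")
  case True
  have "p \<le> 0"
  proof (rule ccontr)
    assume "\<not> p \<le> 0"
    then have p: "p > 0" by simp
    \<comment> \<open>For \<open>D = 0\<close> the exponent is unbounded below. This
      \<open>l\<close> makes \<open>exp (l * t)\<close> exceed \<open>2 / p\<close>, while the
      assumed bound keeps it at most \<open>1 / p\<close>.\<close>
    define l where "l = 2 / (p * t)"
    have l: "l > 0" using p t by (simp add: l_def)
    have "l * t = 2 / p" using p t by (simp add: l_def)
    then have "2 / p < exp (l * t)" using exp_ge_add_one_self[of "l * t"] by linarith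
    moreover have "p * exp (l * t) \<le> 1"
      using le[OF l] True by (simp add: exp_minus field_simps)
    ultimately show False using p by (simp add: field_simps)
  qed
  then show ?thesis using True by (simp add: gauss_tail_def)
next
  case False
  then have D: "D > 0" using D by simp
  \<comment> \<open>The value \<open>4 * t / D\<close> minimises the quadratic exponent in
    \<open>l\<close>.\<close>
  have "p \<le> exp ((4 * t / D)\<^sup>2 * D / 8 - 4 * t / D * t)" using D t by (intro le) simp
  also have "(4 * t / D)\<^sup>2 * D / 8 - 4 * t / D * t = - (2 * t\<^sup>2 / D)"
    using D by (simp add: power2_eq_square field_simps)
  finally show ?thesis using False by (simp add: gauss_tail_def)
qed

text \<open>Independence of the two subvectors is applied to boxes, which are measurable because the
  index sets are finite. This product rule is all that the discretisation takes from graph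
  dependence.\<close>

lemma graph_dependent_vimage:
  assumes prob: "prob_space P" and dep: "graph_dependent P N I E X" and I: "finite I"
    and S: "S \<subseteq> I" and T: "T \<subseteq> I" and disj: "S \<inter> T = {}" and nonadj: "\<forall>i\<in>S. \<forall>j\<in>T. {i, j} \<notin> E"
    and X: "\<And>i. i \<in> I \<Longrightarrow> X i \<in> measurable P (N i)" and B: "\<And>i. i \<in> I \<Longrightarrow> B i \<in> sets (N i)"
  shows "measure P {\<omega> \<in> space P. \<forall>i\<in>S \<union> T. X i \<omega> \<in> B i}
        = measure P {\<omega> \<in> space P. \<forall>i\<in>S. X i \<omega> \<in> B i} * measure P {\<omega> \<in> space P. \<forall>i\<in>T. X i \<omega> \<in> B i}"
proof -
  interpret prob_space P by fact
  have indep: "indep_var (Pi\<^sub>M S N) (\<lambda>\<omega>. \<lambda>i\<in>S. X i \<omega>) (Pi\<^sub>M T N) (\<lambda>\<omega>. \<lambda>j\<in>T. X j \<omega>)"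
    using dep S T disj nonadj unfolding graph_dependent_def by simp
  have sets: "Pi\<^sub>E U B \<in> sets (Pi\<^sub>M U N)" if "U \<subseteq> I" for U
    using that I B finite_subset by (intro sets_PiM_I_finite) auto
  have mem: "(\<lambda>i\<in>U. X i \<omega>) \<in> Pi\<^sub>E U B \<longleftrightarrow> (\<forall>i\<in>U. X i \<omega> \<in> B i)" for U \<omega>
    by (auto simp: PiE_iff)
  have vim: "(\<lambda>\<omega>. \<lambda>i\<in>U. X i \<omega>) -` Pi\<^sub>E U B \<inter> space P = {\<omega> \<in> space P. \<forall>i\<in>U. X i \<omega> \<in> B i}" for U
    using mem by blast
  have "(\<lambda>\<omega>. (\<lambda>i\<in>S. X i \<omega>, \<lambda>j\<in>T. X j \<omega>)) -` (Pi\<^sub>E S B \<times> Pi\<^sub>E T B) \<inter> space P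
      = {\<omega> \<in> space P. \<forall>i\<in>S \<union> T. X i \<omega> \<in> B i}"
    using mem by auto
  with indep_varD[OF indep sets[OF S] sets[OF T]] show ?thesis
    unfolding vim by simp
qed

theorem theorem2p1:
  fixes n :: nat
    and \<Omega> :: "nat \<Rightarrow> 'a topology"
    and c :: "nat \<Rightarrow> real"
    and f :: "(nat \<Rightarrow> 'a) \<Rightarrow> real"
    and E :: "nat set set"
    and P :: "'w measure"
    and X :: "nat \<Rightarrow> 'w \<Rightarrow> 'a"
    and t :: real
  assumes "n \<ge> 1"
    and "\<And>i. i \<in> {1..n} \<Longrightarrow> polish_topology (\<Omega> i)"
    and "\<And>i. i \<in> {1..n} \<Longrightarrow> c i \<ge> 0"
    and "f \<in> borel_measurable (Pi\<^sub>M {1..n} (\<lambda>i. borel_of (\<Omega> i)))"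
    and "lipschitz_weighted {1..n} (\<lambda>i. topspace (\<Omega> i)) c f"
    and "simple_graph {1..n} E"
    and "prob_space P"
    and "\<And>i. i \<in> {1..n} \<Longrightarrow> X i \<in> measurable P (borel_of (\<Omega> i))"
    and "graph_dependent P (\<lambda>i. borel_of (\<Omega> i)) {1..n} E X"
    and "graph_tree {1..n} E"
    and "t > 0"
  shows "measure P {\<omega> \<in> space P.
            f (\<lambda>i\<in>{1..n}. X i \<omega>)
              - prob_space.expectation P (\<lambda>\<omega>'. f (\<lambda>i\<in>{1..n}. X i \<omega>')) \<ge> t}
         \<le> gauss_tail ((Min (c ` {1..n}))\<^sup>2 + (\<Sum>e\<in>E. (\<Sum>i\<in>e. c i)\<^sup>2)) t"
proof -
  let ?I = "{1..n}"
  interpret prob_space P by fact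
  note polish = assms(2) and c = assms(3) and f = assms(4) and lip = assms(5)
    and X = assms(8) and dep = assms(9) and tree = assms(10)
  obtain \<omega>0 where \<omega>0: "\<omega>0 \<in> space P" using not_empty by blast
  have "\<exists>\<Phi>. \<exists>R. i \<in> ?I \<longrightarrow> \<Phi> \<in> borel_measurable (borel_of (\<Omega> i)) \<and>
      R \<in> measurable borel (borel_of (\<Omega> i)) \<and> (\<forall>x\<in>topspace (\<Omega> i). R ((\<Phi> x) :: nat \<Rightarrow> real) = x)" for i
  proof (cases "i \<in> ?I")
    case True
    \<comment> \<open>A probability space has a point, and its image under \<open>X i\<close> lies
      in the carrier.\<close>
    have "topspace (\<Omega> i) \<noteq> {}" using measurable_space[OF X[OF True] \<omega>0] by auto
    from polish_measurable_section[OF polish[OF True] this] show ?thesis by metis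
  qed auto
  then obtain \<Phi> R where \<Phi>: "\<And>i. i \<in> ?I \<Longrightarrow> \<Phi> i \<in> borel_measurable (borel_of (\<Omega> i))"
    and R: "\<And>i. i \<in> ?I \<Longrightarrow> R i \<in> measurable borel (borel_of (\<Omega> i))"
    and R\<Phi>: "\<And>i x. i \<in> ?I \<Longrightarrow> x \<in> topspace (\<Omega> i) \<Longrightarrow> R i ((\<Phi> i x) :: nat \<Rightarrow> real) = x"
    by metis
  define Z where "Z i \<omega> = (if i \<in> ?I then \<Phi> i (X i \<omega>) else (\<lambda>_. 0))" for i \<omega>
  \<comment> \<open>The embedded vector \<open>Z\<close> takes values in one Polish type, and
    \<open>g\<close> of it equals \<open>f\<close> of the original vector.\<close>
  define g where "g y = f (\<lambda>i\<in>?I. R i (y i))" for y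
  have Z: "Z i \<in> borel_measurable P" for i
    using measurable_compose[OF X \<Phi>, of i] by (cases "i \<in> ?I") (auto simp: Z_def[abs_def])
  have gZ: "g (\<lambda>i. Z i \<omega>) = f (\<lambda>i\<in>?I. X i \<omega>)" if "\<omega> \<in> space P" for \<omega>
    unfolding g_def
  proof (intro arg_cong[where f = f] restrict_ext)
    fix i assume i: "i \<in> ?I"
    have "X i \<omega> \<in> topspace (\<Omega> i)" using measurable_space[OF X[OF i] that] by simp
    then show "R i (Z i \<omega>) = X i \<omega>" using i R\<Phi> by (simp add: Z_def)
  qed
  have g: "g \<in> borel_measurable borel"
    unfolding g_def
  proof (rule measurable_compose[OF _ f])
    show "(\<lambda>y. \<lambda>i\<in>?I. R i (y i)) \<in> measurable borel (Pi\<^sub>M ?I (\<lambda>i. borel_of (\<Omega> i)))"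
      by (rule measurable_restrict) (rule measurable_compose[OF measurable_product_coordinates R])
  qed
  have g_lip: "hamming_lipschitz ?I c g"
    unfolding hamming_lipschitz_def
  proof (intro allI)
    fix x y
    have mem: "(\<lambda>i\<in>?I. R i (z i)) \<in> Pi\<^sub>E ?I (\<lambda>i. topspace (\<Omega> i))" for z
      using measurable_space[OF R] by (intro PiE_I) auto
    have "\<bar>g x - g y\<bar> \<le> (\<Sum>i\<in>?I. c i * of_bool ((\<lambda>i\<in>?I. R i (x i)) i \<noteq> (\<lambda>i\<in>?I. R i (y i)) i))"
      unfolding g_def by (rule lip[unfolded lipschitz_weighted_def, THEN bspec, THEN bspec, OF mem mem])
    \<comment> \<open>Applying \<open>R i\<close> can merge coordinates that differ but never
      separates equal ones.\<close>
    also have "\<dots> \<le> (\<Sum>i\<in>?I. c i * of_bool (x i \<noteq> y i))"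
      using c by (intro sum_mono mult_left_mono) (auto simp: of_bool_def)
    finally show "\<bar>g x - g y\<bar> \<le> (\<Sum>i\<in>?I. c i * of_bool (x i \<noteq> y i))" .
  qed
  have Z_dep: "prob {\<omega> \<in> space P. \<forall>i\<in>S \<union> T. Z i \<omega> \<in> A i}
        = prob {\<omega> \<in> space P. \<forall>i\<in>S. Z i \<omega> \<in> A i} * prob {\<omega> \<in> space P. \<forall>i\<in>T. Z i \<omega> \<in> A i}"
    if ST: "S \<subseteq> ?I" "T \<subseteq> ?I" "S \<inter> T = {}" "\<forall>i\<in>S. \<forall>j\<in>T. {i, j} \<notin> E" and A: "\<And>i. A i \<in> sets borel"
    for S T A
  proof -
    define B where "B i = \<Phi> i -` A i \<inter> space (borel_of (\<Omega> i))" for i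
    have B: "B i \<in> sets (borel_of (\<Omega> i))" if "i \<in> ?I" for i
      unfolding B_def by (rule measurable_sets[OF \<Phi>[OF that] A])
    have eq: "{\<omega> \<in> space P. \<forall>i\<in>U. Z i \<omega> \<in> A i} = {\<omega> \<in> space P. \<forall>i\<in>U. X i \<omega> \<in> B i}"
      if U: "U \<subseteq> ?I" for U
    proof -
      have "Z i \<omega> \<in> A i \<longleftrightarrow> X i \<omega> \<in> B i" if "\<omega> \<in> space P" "i \<in> U" for i \<omega>
        using measurable_space[OF X that(1), of i] that U by (auto simp: Z_def B_def)
      then show ?thesis by blast
    qed
    show ?thesis
      unfolding eq[OF ST(1)] eq[OF ST(2)] eq[OF Un_least[OF ST(1,2)]]
      by (rule graph_dependent_vimage[OF \<open>prob_space P\<close> dep _ ST X B]) auto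
  qed
  \<comment> \<open>Rooting the tree at a vertex of least weight makes the root term the smallest
    possible.\<close>
  have "Min (c ` ?I) \<in> c ` ?I" using \<open>n \<ge> 1\<close> by (intro Min_in) auto
  then obtain r where r: "r \<in> ?I" "c r = Min (c ` ?I)" by auto
  have exp_eq: "expectation (\<lambda>\<omega>. g (\<lambda>i. Z i \<omega>)) = expectation (\<lambda>\<omega>. f (\<lambda>i\<in>?I. X i \<omega>))"
    by (intro Bochner_Integration.integral_cong refl gZ)
  show ?thesis
  proof (rule exp_tail_optimize[OF \<open>t > 0\<close>])
    show "0 \<le> (Min (c ` ?I))\<^sup>2 + (\<Sum>e\<in>E. (\<Sum>i\<in>e. c i)\<^sup>2)"
      by (intro add_nonneg_nonneg sum_nonneg) auto
    fix l :: real assume l: "l > 0"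
    have "prob {\<omega> \<in> space P. t \<le> g (\<lambda>i. Z i \<omega>) - expectation (\<lambda>\<omega>. g (\<lambda>i. Z i \<omega>))}
        \<le> exp (l\<^sup>2 * ((c r)\<^sup>2 + (\<Sum>e\<in>E. (sum c e)\<^sup>2)) / 8 - l * t)"
      by (rule rooted_tree_tail_polish[OF \<open>prob_space P\<close> Z g g_lip graph_tree_rooted[OF tree r(1)] c l Z_dep])
    moreover have "{\<omega> \<in> space P. t \<le> g (\<lambda>i. Z i \<omega>) - expectation (\<lambda>\<omega>. g (\<lambda>i. Z i \<omega>))}
        = {\<omega> \<in> space P. t \<le> f (\<lambda>i\<in>?I. X i \<omega>) - expectation (\<lambda>\<omega>. f (\<lambda>i\<in>?I. X i \<omega>))}"
      unfolding exp_eq using gZ by auto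
    ultimately show "prob {\<omega> \<in> space P. t \<le> f (\<lambda>i\<in>?I. X i \<omega>) - expectation (\<lambda>\<omega>. f (\<lambda>i\<in>?I. X i \<omega>))}
        \<le> exp (l\<^sup>2 * ((Min (c ` ?I))\<^sup>2 + (\<Sum>e\<in>E. (\<Sum>i\<in>e. c i)\<^sup>2)) / 8 - l * t)"
      by (simp only: r(2))
  qed
qed

end
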